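(* Let $m=m(n)$ and $s=s(n)$ be positive integers such that $m=o\!\left(\frac{s^2}{(\log n)^2}\right)$ as $n\to\infty$. Let $A$ be chosen uniformly at random from the family of all sets $A\subseteq[n]=\{1,\dots,n\}$ with $|A|=s$ and $|A+A|\le m$. Then there exists a sequence $\eta_n\to0$ such that, with probability tending to $1$ as $n\to\infty$, there is an arithmetic progression $P\subseteq\mathbb{Z}$ with $|P|\le m/2+\eta_n m$ and $|A\setminus P|\le \eta_n s$.
   Context: For $A\subseteq\mathbb{Z}$, $A+A=\{a_1+a_2:a_1,a_2\in A\}$. Logarithms are base $2$. The random set is only defined for $n$ such that the family is nonempty. *)

theory Defs
  imports "HOL-Probability.Probability" "HOL-Library.Landau_Symbols" "HOL-Library.Set_Algebras"
begin

text \<open>Arithmetic progressions are finite and nonempty, with nonzero common difference, so that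
  \<open>card P\<close> is the number of terms.\<close>

definition arith_prog :: "int set \<Rightarrow> bool" where
  "arith_prog P \<longleftrightarrow> (\<exists>a d k. d \<noteq> 0 \<and> 1 \<le> k \<and> P = {a + int i * d | i. i < k})"

definition small_doubling :: "nat \<Rightarrow> nat \<Rightarrow> nat \<Rightarrow> int set set" where
  "small_doubling n s m = {A. A \<subseteq> {1..int n} \<and> card A = s \<and> card (A + A) \<le> m}"

end

theory Submission imports Defs begin

text \<open>
  Containers. Let \<open>A\<close> have \<open>s\<close> elements and at most \<open>m\<close> sums. Fix \<open>T \<subseteq> A\<close> of size about \<open>\<surd>m\<close> and add
  elements of \<open>A\<close> to \<open>S\<close> as long as \<open>S + T\<close> grows by at least half of \<open>T\<close> each time. This stops after
  \<open>O(\<surd>m)\<close> steps, and then \<open>A\<close> lies in the set \<open>popular T S\<close> of size at most \<open>2m\<close>. Describing \<open>T\<close> and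
  \<open>S\<close> costs \<open>O(\<surd>m log n) = o(s)\<close> bits, which is where the hypothesis on \<open>m\<close> enters. Inside a set of
  size \<open>O(m)\<close> a sublinear part of \<open>A\<close> can be specified for free, so one may reveal \<open>F \<subseteq> A\<close> with
  \<open>card F = o(s)\<close> such that \<open>D = F + F\<close> contains almost all sums of pairs from \<open>A\<close>. A Kleitman-Winston
  argument with boundedly many further elements gives a container \<open>B\<close> of almost all of \<open>A\<close> such that,
  for each \<open>x \<in> B\<close>, almost all of \<open>x + B\<close> lies in \<open>D\<close>, where \<open>card D \<le> m\<close>.

  Structure. If \<open>B\<close> has nearly \<open>m / 2\<close> elements \<open>b\<^sub>0 < b\<^sub>1 < \<dots>\<close>, then monotone lattice paths show that
  \<open>b\<^sub>i + b\<^sub>j\<close> has rank close to \<open>i + j\<close> in \<open>D\<close>. Hence every short difference \<open>b\<^sub>q - b\<^sub>p\<close> is an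
  almost-period of \<open>B\<close>, the short differences are closed under sums and differences, and so they are
  exactly the multiples of one number \<open>d\<close>. Counting makes \<open>B\<close> nearly an interval of a residue class
  modulo \<open>d\<close>.

  Counting. The sets \<open>A\<close> whose container is smaller by a constant factor are exponentially few compared
  with the \<open>s\<close>-subsets of an interval of length \<open>m / 2\<close>, all of which have small doubling.
\<close>

section \<open>Sets almost closed under addition into a small set\<close>

lemma sum_card_filter_swap:
  assumes "finite X" "finite Y"
  shows "(\<Sum>x\<in>X. card {y \<in> Y. P x y}) = (\<Sum>y\<in>Y. card {x \<in> X. P x y})"
proof -
  have "(\<Sum>x\<in>X. card {y \<in> Y. P x y}) = (\<Sum>x\<in>X. \<Sum>y\<in>Y. if P x y then 1 else 0)"
    using assms by (intro sum.cong refl) (simp add: sum.If_cases Int_def)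
  also have "\<dots> = (\<Sum>y\<in>Y. \<Sum>x\<in>X. if P x y then 1 else 0)" by (rule sum.swap)
  also have "\<dots> = (\<Sum>y\<in>Y. card {x \<in> X. P x y})"
    using assms by (intro sum.cong refl) (simp add: sum.If_cases Int_def)
  finally show ?thesis .
qed

text \<open>A sumset of \<open>N\<close> integers has at least \<open>2 * N - 1\<close> elements, so
  \<open>card_D\<close> says that \<open>D\<close> is close to the smallest possible size;
  \<open>w\<close> is the resulting tolerance in rank. The term \<open>4 * \<mu> + 2\<close> covers
  what a lower and an upper rank estimate lose together in \<open>sum_less\<close>.\<close>

locale almost_closed_sums =
  fixes b :: "nat \<Rightarrow> int" and N :: nat and D :: "int set" and \<mu> w :: nat
  assumes b_less: "\<And>i j. i < j \<Longrightarrow> j < N \<Longrightarrow> b i < b j"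
    and finite_D: "finite D"
    and missing: "\<And>i. i < N \<Longrightarrow> card {j. j < N \<and> b i + b j \<notin> D} \<le> \<mu>"
    and card_D: "card D + 4 * \<mu> + 2 \<le> 2 * N + w"
begin

lemma b_le: "i \<le> j \<Longrightarrow> j < N \<Longrightarrow> b i \<le> b j"
  using b_less[of i j] by (cases "i = j") auto

lemma b_less_iff: "i < N \<Longrightarrow> j < N \<Longrightarrow> b i < b j \<longleftrightarrow> i < j"
  using b_less[of i j] b_le[of j i] by (cases "i < j") auto

lemma b_eq_iff: "i < N \<Longrightarrow> j < N \<Longrightarrow> b i = b j \<longleftrightarrow> i = j"
  using b_less[of i j] b_less[of j i] by (cases i j rule: linorder_cases) auto

lemma inj_b: "inj_on b {..<N}"
  by (auto simp: inj_on_def b_eq_iff)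

section \<open>Ranks of the sums in \<open>D\<close>\<close>

lemma card_row:
  assumes "i < N" "I \<subseteq> {..<N}"
  shows "card I \<le> card ((\<lambda>l. b i + b l) ` I \<inter> D) + \<mu>"
proof -
  have fin: "finite I" using assms(2) finite_subset by blast
  have inj: "inj_on (\<lambda>l. b i + b l) {l \<in> I. b i + b l \<in> D}"
    using assms(2) inj_b by (auto simp: inj_on_def)
  have eq: "(\<lambda>l. b i + b l) ` I \<inter> D = (\<lambda>l. b i + b l) ` {l \<in> I. b i + b l \<in> D}" by auto
  have "I = {l \<in> I. b i + b l \<in> D} \<union> {l \<in> I. b i + b l \<notin> D}" by auto
  then have "card I \<le> card {l \<in> I. b i + b l \<in> D} + card {l \<in> I. b i + b l \<notin> D}"
    by (metis card_Un_le)
  also have "card {l \<in> I. b i + b l \<notin> D} \<le> card {j. j < N \<and> b i + b j \<notin> D}"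
    by (rule card_mono) (use assms(2) in auto)
  also have "\<dots> \<le> \<mu>" by (rule missing[OF assms(1)])
  finally show ?thesis unfolding eq card_image[OF inj] by simp
qed

text \<open>The index pairs (0, 0), ..., (0, j), (1, j), ..., (i, j) form a monotone lattice path
  along which the \<open>i + j + 1\<close> sums strictly increase. Each of its two straight pieces
  loses at most \<open>\<mu>\<close> sums outside \<open>D\<close>.\<close>

lemma card_below:
  assumes "i < N" "j < N"
  shows "i + j + 1 \<le> card {z \<in> D. z \<le> b i + b j} + 2 * \<mu>"
proof -
  let ?P = "(\<lambda>l. b 0 + b l) ` {..j} \<inter> D" and ?Q = "(\<lambda>l. b j + b l) ` {1..i} \<inter> D"
  have "card {..j} \<le> card ?P + \<mu>" by (rule card_row) (use assms in auto)
  moreover have "card {1..i} \<le> card ?Q + \<mu>" by (rule card_row) (use assms in auto)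
  moreover have "card (?P \<union> ?Q) = card ?P + card ?Q"
  proof (rule card_Un_disjoint)
    have False if "k \<le> j" "l \<in> {1..i}" "b 0 + b k = b j + b l" for k l
      using that b_le[of k j] b_less[of 0 l] assms by auto
    then show "?P \<inter> ?Q = {}" by blast
  qed auto
  moreover have "card (?P \<union> ?Q) \<le> card {z \<in> D. z \<le> b i + b j}"
  proof (rule card_mono)
    have "b 0 + b l \<le> b i + b j" if "l \<le> j" for l
      using that b_le[of 0 i] b_le[of l j] assms by auto
    moreover have "b j + b l \<le> b i + b j" if "l \<in> {1..i}" for l
      using that b_le[of l i] assms by auto
    ultimately show "?P \<union> ?Q \<subseteq> {z \<in> D. z \<le> b i + b j}" by auto
  qed (use finite_D in auto)
  ultimately show ?thesis by simp
qed

text \<open>The mirror image of \<open>card_below\<close>: the path runs from (i, j) to (N - 1, N -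
  1), in pieces of \<open>N - 1 - i\<close> and \<open>N - j\<close> sums.\<close>

lemma card_above:
  assumes "i < N" "j < N"
  shows "2 * N \<le> card {z \<in> D. b i + b j \<le> z} + i + j + 1 + 2 * \<mu>"
proof -
  let ?P = "(\<lambda>l. b (N - 1) + b l) ` {j..<N} \<inter> D" and ?Q = "(\<lambda>l. b j + b l) ` {i..<N-1} \<inter> D"
  have "card {j..<N} \<le> card ?P + \<mu>" by (rule card_row) (use assms in auto)
  moreover have "card {i..<N-1} \<le> card ?Q + \<mu>" by (rule card_row) (use assms in auto)
  moreover have "card (?P \<union> ?Q) = card ?P + card ?Q"
  proof (rule card_Un_disjoint)
    have False if "k \<in> {j..<N}" "l \<in> {i..<N-1}" "b (N-1) + b k = b j + b l" for k l
      using that b_le[of j k] b_less[of l "N-1"] assms by auto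
    then show "?P \<inter> ?Q = {}" by blast
  qed auto
  moreover have "card (?P \<union> ?Q) \<le> card {z \<in> D. b i + b j \<le> z}"
  proof (rule card_mono)
    have "i \<le> N - 1" "N - 1 < N" using assms by auto
    then have "b i \<le> b (N - 1)" by (rule b_le)
    then have "b i + b j \<le> b (N-1) + b l" if "l \<in> {j..<N}" for l
      using that b_le[of j l] by auto
    moreover have "b i + b j \<le> b j + b l" if "l \<in> {i..<N-1}" for l
      using that b_le[of i l] assms by auto
    ultimately show "?P \<union> ?Q \<subseteq> {z \<in> D. b i + b j \<le> z}" by auto
  qed (use finite_D in auto)
  ultimately show ?thesis using assms by (simp; arith)
qed

lemma card_D_lower:
  assumes "0 < N"
  shows "2 * N \<le> card D + 2 * \<mu> + 1"
proof -
  have "card {z \<in> D. z \<le> b (N-1) + b (N-1)} \<le> card D"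
    by (rule card_mono) (use finite_D in auto)
  with card_below[of "N-1" "N-1"] assms show ?thesis by auto
qed

lemma missing_le_width: "0 < N \<Longrightarrow> 2 * \<mu> + 1 \<le> w"
  using card_D_lower card_D by simp

text \<open>In the reversed order, the part of \<open>D\<close> up to \<open>b k + b l\<close> and
  the part from \<open>b i + b j\<close> on would share at most one element, but the two rank bounds
  make their sizes add up to more than \<open>card D + 1\<close>.\<close>

lemma sum_less:
  assumes "i < N" "j < N" "k < N" "l < N" "i + j + w \<le> k + l"
  shows "b i + b j < b k + b l"
proof (rule ccontr)
  assume "\<not> ?thesis"
  then have le: "b k + b l \<le> b i + b j" by simp
  let ?P = "{z \<in> D. z \<le> b k + b l}" and ?Q = "{z \<in> D. b i + b j \<le> z}"
  have "card ?P + card ?Q = card (?P \<union> ?Q) + card (?P \<inter> ?Q)"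
    using finite_D by (intro card_Un_Int) auto
  also have "card (?P \<union> ?Q) \<le> card D"
    by (rule card_mono) (use finite_D in auto)
  also have "card (?P \<inter> ?Q) \<le> card {b k + b l}"
    by (rule card_mono) (use le in auto)
  finally have "card ?P + card ?Q \<le> card D + 1" by simp
  with card_below[OF assms(3,4)] card_above[OF assms(1,2)] card_D assms(5)
  show False by linarith
qed

section \<open>Almost-periods and enclosure in a progression\<close>

definition B where "B = b ` {..<N}"

lemma finite_B: "finite B" and card_B: "card B = N"
  unfolding B_def by (simp_all add: card_image inj_b)

text \<open>Up to \<open>2 * \<mu>\<close> exceptions the union lies in \<open>D\<close> between
  \<open>b 0 + b p\<close> and \<open>b (N - 1) + b q\<close>. By the rank bounds about
  \<open>p\<close> elements of \<open>D\<close> lie below this range and about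
  \<open>N - 1 - q\<close> above it. The remaining multiples of \<open>\<mu>\<close> are absorbed by
  \<open>missing_le_width\<close>.\<close>

lemma card_two_translates:
  assumes "p < q" "q < N"
  shows "card ((\<lambda>x. x + b p) ` B \<union> (\<lambda>x. x + b q) ` B) \<le> N + (q - p) + 2 * w"
proof -
  let ?P = "{z \<in> D. z < b 0 + b p}" and ?Q = "{z \<in> D. b (N-1) + b q < z}"
  let ?U = "(\<lambda>x. x + b p) ` B" and ?V = "(\<lambda>x. x + b q) ` B"
  have N: "0 < N" "p < N" using assms by auto
  have U: "?U = (\<lambda>l. b p + b l) ` {..<N}" and V: "?V = (\<lambda>l. b q + b l) ` {..<N}"
    unfolding B_def by (auto simp: image_image add.commute)
  have row: "card (((\<lambda>l. b i + b l) ` {..<N}) - D) \<le> \<mu>" if "i < N" for i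
  proof -
    have "((\<lambda>l. b i + b l) ` {..<N}) - D = (\<lambda>l. b i + b l) ` {j. j < N \<and> b i + b j \<notin> D}" by auto
    then show ?thesis using missing[OF that] card_image_le[of "{j. j < N \<and> b i + b j \<notin> D}" "\<lambda>l. b i + b l"]
      by simp
  qed
  have "card {z \<in> D. z \<le> b 0 + b p} \<le> card (?P \<union> {b 0 + b p})"
    by (rule card_mono) (use finite_D in auto)
  also have "\<dots> \<le> card ?P + 1"
    using card_Un_le[of ?P "{b 0 + b p}"] by simp
  finally have P: "p \<le> card ?P + 2 * \<mu>" using card_below[of 0 p] N by simp
  have "card {z \<in> D. b (N-1) + b q \<le> z} \<le> card (?Q \<union> {b (N-1) + b q})"
    by (rule card_mono) (use finite_D in auto)
  also have "\<dots> \<le> card ?Q + 1"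
    using card_Un_le[of ?Q "{b (N-1) + b q}"] by simp
  finally have Q: "N \<le> card ?Q + q + 1 + 2 * \<mu>" using card_above[of "N-1" q] assms N by simp
  have "card (?U \<union> ?V) \<le> card (((?U \<union> ?V) \<inter> D) \<union> (?U - D) \<union> (?V - D))"
    by (rule card_mono) (use finite_B in auto)
  also have "\<dots> \<le> card ((?U \<union> ?V) \<inter> D) + card (?U - D) + card (?V - D)"
    by (meson add_mono card_Un_le le_trans order_refl)
  also have "\<dots> \<le> card ((?U \<union> ?V) \<inter> D) + 2 * \<mu>"
    using row[of p] row[of q] assms unfolding U V by simp
  finally have M: "card (?U \<union> ?V) \<le> card ((?U \<union> ?V) \<inter> D) + 2 * \<mu>" .
  let ?M = "(?U \<union> ?V) \<inter> D"
  have range: "b 0 + b p \<le> z \<and> z \<le> b (N-1) + b q" if z: "z \<in> ?U \<union> ?V" for z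
  proof -
    obtain l where l: "l < N" "z = b l + b p \<or> z = b l + b q" using z unfolding B_def by blast
    then have "l \<le> N - 1" "N - 1 < N" by auto
    then have "b l \<le> b (N - 1)" by (rule b_le)
    then show ?thesis using l b_le[of 0 l] b_less[of p q] assms by auto
  qed
  have "card (?P \<union> ?M \<union> ?Q) = card (?P \<union> ?M) + card ?Q"
    by (rule card_Un_disjoint) (use finite_D range b_le[of 0 "N-1"] b_less[of p q] assms in \<open>force+\<close>)
  also have "card (?P \<union> ?M) = card ?P + card ?M"
    by (rule card_Un_disjoint) (use finite_D range in force)+
  finally have "card ?P + card ?M + card ?Q \<le> card D"
    using card_mono[of D "?P \<union> ?M \<union> ?Q"] finite_D by auto
  with P Q M card_D missing_le_width[OF N(1)] assms show ?thesis by linarith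
qed

lemma card_not_shift_uminus:
  "card {x \<in> B. x - \<delta> \<notin> B} = card {x \<in> B. x + \<delta> \<notin> B}"
proof -
  have "bij_betw (\<lambda>x. x + \<delta>) {x \<in> B. x + \<delta> \<in> B} {x \<in> B. x - \<delta> \<in> B}"
    by (rule bij_betwI[where g = "\<lambda>x. x - \<delta>"]) auto
  then have "card {x \<in> B. x + \<delta> \<in> B} = card {x \<in> B. x - \<delta> \<in> B}" by (rule bij_betw_same_card)
  moreover have "{x \<in> B. x + \<delta> \<notin> B} = B - {x \<in> B. x + \<delta> \<in> B}"
    and "{x \<in> B. x - \<delta> \<notin> B} = B - {x \<in> B. x - \<delta> \<in> B}" by auto
  ultimately show ?thesis using finite_B by (simp add: card_Diff_subset)
qed

text \<open>The union of the translates by \<open>b p\<close> and \<open>b q\<close> exceeds the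
  latter by one element for each \<open>x\<close> in \<open>B\<close> whose shift by
  \<open>b p - b q\<close> leaves \<open>B\<close>. Hence elements of nearby index differ by an
  almost-period.\<close>

lemma card_not_shift:
  assumes "p < q" "q < N"
  shows "card {x \<in> B. x + (b q - b p) \<notin> B} \<le> (q - p) + 2 * w"
proof -
  let ?\<delta> = "b q - b p"
  let ?U = "(\<lambda>x. x + b p) ` B" and ?V = "(\<lambda>x. x + b q) ` B" and ?W = "(\<lambda>x. x + b p) ` {x \<in> B. x - ?\<delta> \<notin> B}"
  have "?U \<union> ?V = ?V \<union> ?W"
    by (auto simp: image_iff algebra_simps) (metis diff_add_cancel)
  moreover have "card (?V \<union> ?W) = card ?V + card ?W"
  proof (rule card_Un_disjoint)
    have "y - ?\<delta> \<in> B" if "x \<in> B" "x + b q = y + b p" for x y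
    proof -
      have "y - ?\<delta> = x" using that by simp
      with that(1) show ?thesis by metis
    qed
    then show "?V \<inter> ?W = {}" by blast
  qed (use finite_B in auto)
  moreover have "card ?V = N" "card ?W = card {x \<in> B. x - ?\<delta> \<notin> B}"
    by (simp_all add: card_image card_B)
  ultimately show ?thesis
    using card_two_translates[OF assms] card_not_shift_uminus[of ?\<delta>] by simp
qed

lemma exists_unshifted:
  assumes "card {x \<in> B. x + \<delta> \<notin> B} + card {x \<in> B. x + \<epsilon> \<notin> B} < N"
  shows "\<exists>x \<in> B. x + \<delta> \<in> B \<and> x + \<epsilon> \<in> B"
proof (rule ccontr)
  assume "\<not> ?thesis"
  then have "B \<subseteq> {x \<in> B. x + \<delta> \<notin> B} \<union> {x \<in> B. x + \<epsilon> \<notin> B}" by auto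
  then have "N \<le> card ({x \<in> B. x + \<delta> \<notin> B} \<union> {x \<in> B. x + \<epsilon> \<notin> B})"
    using card_mono[of "{x \<in> B. x + \<delta> \<notin> B} \<union> {x \<in> B. x + \<epsilon> \<notin> B}" B] finite_B card_B by auto
  with assms show False using card_Un_le[of "{x \<in> B. x + \<delta> \<notin> B}" "{x \<in> B. x + \<epsilon> \<notin> B}"] by linarith
qed

text \<open>The differences not exceeding the shortest distance \<open>G\<close> spanned by
  \<open>H\<close> index steps are almost-periods. They are therefore closed under addition up to
  \<open>G\<close> and under subtraction, hence are the multiples of their minimum \<open>d\<close>.
  Counting these multiples bounds \<open>K\<close>, and \<open>J\<close> windows of length
  \<open>G\<close> cover \<open>B\<close>.\<close>

theorem subset_arith_prog:
  assumes "w < H" "2 * (H + 2 * w) < N" "N \<le> J * (H - w)"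
  shows "\<exists>P K. arith_prog P \<and> B \<subseteq> P \<and> card P = J * (K + 1) + 1 \<and> K * (N - (H + 2 * w)) \<le> N * H"
proof -
  have H: "H < N" "0 < H" using assms by auto
  \<comment> \<open>The window of \<open>H\<close> steps with the smallest span. By minimality, a
    difference of at most \<open>G\<close> spans at most \<open>H\<close> indices.\<close>
  define p0 where "p0 = arg_min_on (\<lambda>p. b (p + H) - b p) {..<N - H}"
  have ne: "{..<N - H} \<noteq> {}" using H by (simp add: lessThan_empty_iff)
  have p0: "p0 < N - H" "\<And>p. p < N - H \<Longrightarrow> b (p0 + H) - b p0 \<le> b (p + H) - b p"
    using arg_min_if_finite(1)[of "{..<N-H}" "\<lambda>p. b (p + H) - b p"]
      arg_min_least[of "{..<N-H}" _ "\<lambda>p. b (p + H) - b p"] ne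
    unfolding p0_def by auto
  define G where "G = b (p0 + H) - b p0"
  define R where "R = {\<delta>. 0 < \<delta> \<and> \<delta> \<le> G \<and> (\<exists>x \<in> B. x + \<delta> \<in> B)}"
  have index: "q - p \<le> H" if "p < N" "q < N" "b q - b p \<le> G" for p q
  proof (rule ccontr)
    assume "\<not> ?thesis"
    then have "p + H < q" "p < N - H" using that(2) by auto
    then show False using that p0(2)[of p] b_less[of "p + H" q] unfolding G_def by auto
  qed
  have shift: "card {x \<in> B. x + \<delta> \<notin> B} \<le> H + 2 * w" if \<delta>: "\<delta> \<in> R" for \<delta>
  proof -
    obtain x where "x \<in> B" "x + \<delta> \<in> B" "0 < \<delta>" "\<delta> \<le> G"
      using \<delta> unfolding R_def by auto
    then obtain p q where pq: "p < N" "q < N" "b q = b p + \<delta>" "0 < \<delta>" "\<delta> \<le> G"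
      unfolding B_def by (metis (no_types, lifting) imageE lessThan_iff)
    then have "p < q" using b_less_iff[of p q] by auto
    with card_not_shift[of p q] index[of p q] pq show ?thesis by auto
  qed
  have shift': "card {x \<in> B. x - \<delta> \<notin> B} \<le> H + 2 * w" if "\<delta> \<in> R" for \<delta>
    using shift[OF that] card_not_shift_uminus by simp
  have add: "\<delta> + \<epsilon> \<in> R" if "\<delta> \<in> R" "\<epsilon> \<in> R" "\<delta> + \<epsilon> \<le> G" for \<delta> \<epsilon>
  proof -
    \<comment> \<open>Each of the two shifts fails for at most \<open>H + 2 * w\<close> elements,
      which is less than \<open>N / 2\<close>, so some \<open>x\<close> admits both; the sum is then
      realised between \<open>x - \<delta>\<close> and \<open>x + \<epsilon>\<close>.\<close>
    have "\<exists>x \<in> B. x + (- \<delta>) \<in> B \<and> x + \<epsilon> \<in> B"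
      using shift'[OF that(1)] shift[OF that(2)] assms(2) by (intro exists_unshifted) simp
    then obtain x where "x \<in> B" "x - \<delta> \<in> B" "x + \<epsilon> \<in> B" by auto
    then have "\<exists>y \<in> B. y + (\<delta> + \<epsilon>) \<in> B"
      by (intro bexI[of _ "x - \<delta>"]) (auto simp: algebra_simps)
    then show ?thesis using that unfolding R_def by auto
  qed
  have diff: "\<delta> - \<epsilon> \<in> R" if "\<delta> \<in> R" "\<epsilon> \<in> R" "\<epsilon> < \<delta>" for \<delta> \<epsilon>
  proof -
    have "\<exists>x \<in> B. x + \<delta> \<in> B \<and> x + \<epsilon> \<in> B"
      using shift[OF that(1)] shift[OF that(2)] assms(2) by (intro exists_unshifted) simp
    then obtain x where "x \<in> B" "x + \<delta> \<in> B" "x + \<epsilon> \<in> B" by auto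
    then have "\<exists>y \<in> B. y + (\<delta> - \<epsilon>) \<in> B"
      by (intro bexI[of _ "x + \<epsilon>"]) auto
    then show ?thesis using that unfolding R_def by auto
  qed
  have gap: "b (Suc i) - b i \<in> R" if "Suc i < N" for i
  proof -
    \<comment> \<open>The index sums differ by \<open>H - 1\<close>, which is at least
      \<open>w\<close>.\<close>
    have "b (Suc i) + b p0 < b i + b (p0 + H)"
      by (rule sum_less) (use that p0(1) assms in auto)
    then have "b (Suc i) - b i \<le> G" unfolding G_def by simp
    moreover have "\<exists>x \<in> B. x + (b (Suc i) - b i) \<in> B"
      unfolding B_def by (intro bexI[of _ "b i"]) (use that in auto)
    ultimately show ?thesis using b_less[of i "Suc i"] that unfolding R_def by auto
  qed
  define d where "d = Min R"
  have "finite R" by (rule finite_subset[of _ "{0..G}"]) (auto simp: R_def)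
  moreover have "R \<noteq> {}" using gap[of 0] H by auto
  ultimately have d: "d \<in> R" "\<And>\<delta>. \<delta> \<in> R \<Longrightarrow> d \<le> \<delta>" unfolding d_def by auto
  have d_pos: "0 < d" "d \<le> G" using d(1) unfolding R_def by auto
  have dvd: "d dvd \<delta>" if "\<delta> \<in> R" for \<delta>
    using that
  \<comment> \<open>The subtractive Euclidean algorithm: removing \<open>d\<close> stays in
    \<open>R\<close> and reaches \<open>d\<close> itself, since nothing in \<open>R\<close> is
    smaller.\<close>
  proof (induction "nat \<delta>" arbitrary: \<delta> rule: less_induct)
    case less
    show ?case
    proof (cases "\<delta> = d")
      case False
      with d(2)[OF less.prems] have "d < \<delta>" by simp
      then have "d dvd \<delta> - d" using diff[OF less.prems d(1)] d_pos by (intro less.hyps) auto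
      then show ?thesis by (metis dvd_add_triv_right_iff diff_add_cancel)
    qed simp
  qed
  have multiple: "int (Suc k) * d \<in> R" if "int (Suc k) * d \<le> G" for k
    using that
  proof (induction k)
    case (Suc k)
    have "int (Suc k) * d + d \<in> R"
      using Suc d(1) d_pos by (intro add) (auto simp: algebra_simps)
    then show ?case by (simp add: algebra_simps)
  qed (use d(1) in simp)
  have cong: "d dvd b i - b 0" if "i < N" for i
    using that
  proof (induction i)
    case (Suc i)
    then have "d dvd (b (Suc i) - b i) + (b i - b 0)"
      using dvd[OF gap[of i]] by (intro dvd_add) auto
    then show ?case by simp
  qed simp
  define K where "K = nat (G div d)"
  have K: "int K * d \<le> G" "G < (int K + 1) * d"
  proof -
    have "int K = G div d" using d_pos unfolding K_def by (simp add: pos_imp_zdiv_nonneg_iff)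
    then have "int K * d + G mod d = G" by simp
    moreover have "0 \<le> G mod d" "G mod d < d" using d_pos by simp_all
    ultimately have "int K * d \<le> G \<and> G < int K * d + d" by linarith
    then show "int K * d \<le> G" "G < (int K + 1) * d" by (simp_all add: algebra_simps)
  qed
  \<comment> \<open>Double counting of the pairs (x, k): every multiple of \<open>d\<close> up to
    \<open>G\<close> is an almost-period, while at most \<open>H\<close> elements of
    \<open>B\<close> lie within distance \<open>G\<close> above a given \<open>x\<close>.\<close>
  have density: "K * (N - (H + 2 * w)) \<le> N * H"
  proof -
    let ?E = "\<lambda>x k. x + int (Suc k) * d \<in> B"
    have "K * (N - (H + 2 * w)) = (\<Sum>k<K. N - (H + 2 * w))" by simp
    also have "\<dots> \<le> (\<Sum>k<K. card {x \<in> B. ?E x k})"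
    proof (rule sum_mono)
      fix k assume "k \<in> {..<K}"
      then have "int (Suc k) * d \<le> int K * d" using d_pos by (intro mult_right_mono) auto
      with K(1) have "int (Suc k) * d \<in> R" by (intro multiple) simp
      then have "card {x \<in> B. \<not> ?E x k} \<le> H + 2 * w" by (rule shift)
      moreover have "{x \<in> B. ?E x k} = B - {x \<in> B. \<not> ?E x k}" by auto
      then have "card {x \<in> B. ?E x k} = N - card {x \<in> B. \<not> ?E x k}"
        using finite_B card_B by (simp add: card_Diff_subset)
      ultimately show "N - (H + 2 * w) \<le> card {x \<in> B. ?E x k}" by simp
    qed
    also have "\<dots> = (\<Sum>x\<in>B. card {k \<in> {..<K}. ?E x k})"
      by (rule sum_card_filter_swap) (simp_all add: finite_B)
    also have "\<dots> \<le> (\<Sum>x\<in>B. H)"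
    proof (rule sum_mono)
      fix x assume "x \<in> B"
      then obtain p where p: "p < N" "x = b p" unfolding B_def by auto
      have "(\<lambda>k. x + int (Suc k) * d) ` {k \<in> {..<K}. ?E x k} \<subseteq> b ` {p<..p + H}"
      proof (rule image_subsetI)
        fix k assume "k \<in> {k \<in> {..<K}. ?E x k}"
        then have k: "k \<in> {..<K}" "?E x k" by simp_all
        from k(2) obtain q where q: "q < N" "x + int (Suc k) * d = b q" unfolding B_def by blast
        have "int (Suc k) * d \<le> int K * d" "0 < int (Suc k) * d"
          using d_pos k by (auto intro: mult_right_mono)
        then have "b p < b q" "b q - b p \<le> G" using q p K(1) by auto
        with index[of p q] b_less_iff[of p q] p q have "q \<in> {p<..p + H}" by auto
        with q show "x + int (Suc k) * d \<in> b ` {p<..p + H}" by auto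
      qed
      then have "card ((\<lambda>k. x + int (Suc k) * d) ` {k \<in> {..<K}. ?E x k}) \<le> card (b ` {p<..p + H})"
        by (intro card_mono) auto
      also have "\<dots> \<le> H" using card_image_le[of "{p<..p + H}" b] by simp
      also have "card ((\<lambda>k. x + int (Suc k) * d) ` {k \<in> {..<K}. ?E x k}) = card {k \<in> {..<K}. ?E x k}"
        using d_pos by (intro card_image) (auto simp: inj_on_def)
      finally show "card {k \<in> {..<K}. ?E x k} \<le> H" .
    qed
    finally show ?thesis using card_B by simp
  qed
  \<comment> \<open>By \<open>sum_less\<close>, any \<open>H - w\<close> index steps cover at most
    the distance \<open>G\<close>, the span of even the shortest window of \<open>H\<close>
    steps.\<close>
  have span: "b (min (N - 1) (j * (H - w))) - b 0 \<le> int j * G" for j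
  proof (induction j)
    case (Suc j)
    let ?i = "min (N - 1) (j * (H - w))" and ?i' = "min (N - 1) (Suc j * (H - w))"
    have "b ?i' + b p0 \<le> b ?i + b (p0 + H)"
    proof (cases "?i' = ?i")
      case True
      then show ?thesis using b_le[of p0 "p0 + H"] p0(1) by auto
    next
      case False
      have "b ?i' + b p0 < b ?i + b (p0 + H)"
        using p0(1) assms H by (intro sum_less) (auto simp: min_def)
      then show ?thesis by simp
    qed
    then have "b ?i' - b ?i \<le> G" unfolding G_def by simp
    with Suc show ?case by (simp add: algebra_simps)
  qed simp
  define P where "P = {b 0 + int i * d | i. i < J * (K + 1) + 1}"
  have "B \<subseteq> P"
  proof
    fix x assume "x \<in> B"
    then obtain i where i: "i < N" "x = b i" unfolding B_def by auto
    obtain t where t: "b i - b 0 = d * t" using cong[OF i(1)] by auto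
    have "i \<le> N - 1" "N - 1 < N" using i by auto
    then have "b i \<le> b (N - 1)" by (rule b_le)
    also have "b (N - 1) - b 0 \<le> int J * G" using span[of J] assms(3) by (simp add: min_def split: if_splits)
    finally have "d * t \<le> int J * G" using t by simp
    also have "\<dots> \<le> int J * ((int K + 1) * d)" using K(2) by (intro mult_left_mono) auto
    also have "\<dots> = d * (int J * (int K + 1))" by simp
    finally have "t \<le> int J * (int K + 1)" using d_pos by simp
    moreover have "0 \<le> t"
    proof -
      have "0 \<le> d * t" using t b_le[of 0 i] i by simp
      then show ?thesis using d_pos by (simp add: zero_le_mult_iff)
    qed
    ultimately have "nat t < J * (K + 1) + 1" "x = b 0 + int (nat t) * d"
      using t i by (auto simp: nat_less_iff algebra_simps)
    then show "x \<in> P" unfolding P_def by blast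
  qed
  moreover have "arith_prog P"
    unfolding arith_prog_def P_def using d_pos by (intro exI[of _ "b 0"] exI[of _ d] exI[of _ "J * (K + 1) + 1"]) auto
  moreover have "card P = J * (K + 1) + 1"
  proof -
    have "P = (\<lambda>i. b 0 + int i * d) ` {..<J * (K + 1) + 1}" unfolding P_def by auto
    moreover have "inj_on (\<lambda>i. b 0 + int i * d) {..<J * (K + 1) + 1}"
      using d_pos by (auto simp: inj_on_def)
    ultimately show ?thesis by (simp add: card_image)
  qed
  ultimately show ?thesis using density by (intro exI[of _ P] exI[of _ K] conjI)
qed

end

text \<open>The scales are \<open>w\<close> at most \<open>\<theta>\<^sup>2 * N\<close> and
  \<open>H\<close> about \<open>\<theta> * N\<close>. Up to factors 1 + O(\<theta>),
  \<open>J\<close> is then at most 1 / \<theta> and \<open>K + 1\<close> at most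
  \<open>\<theta> * N\<close>, so the progression has at most slightly more than \<open>N\<close>
  terms, and \<open>card_D_lower\<close> bounds \<open>N\<close> by slightly more than
  \<open>m / 2\<close>. The threshold \<open>m0\<close> makes rounding harmless.\<close>

lemma subset_arith_prog_of_almost_closed:
  fixes \<eta> :: real
  assumes "0 < \<eta>"
  obtains \<kappa> m0 :: real where "0 < \<kappa>" "\<kappa> \<le> 1 / 9"
    "\<And>B D :: int set. \<And>m :: nat. \<lbrakk>m0 \<le> real m; finite B; finite D; card D \<le> m;
       \<And>x. x \<in> B \<Longrightarrow> real (card {y \<in> B. x + y \<notin> D}) \<le> \<kappa> * real m;
       (1 - 3 * \<kappa>) * real m / 2 \<le> real (card B)\<rbrakk>
     \<Longrightarrow> \<exists>P. arith_prog P \<and> B \<subseteq> P \<and> real (card P) \<le> real m / 2 + \<eta> * real m"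
proof -
  define \<theta> where "\<theta> = min \<eta> 1 / 100"
  define \<kappa> where "\<kappa> = \<theta>\<^sup>2 / 24"
  define m0 where "m0 = 300 / \<theta>\<^sup>2"
  have \<theta>: "0 < \<theta>" "\<theta> \<le> 1/100" "5 * \<theta> \<le> \<eta>" using assms by (auto simp: \<theta>_def)
  have \<theta>2: "0 < \<theta>\<^sup>2" "\<theta>\<^sup>2 \<le> \<theta> / 100"
    using \<theta> mult_left_mono[of \<theta> "1/100" \<theta>] by (auto simp: power2_eq_square)
  have \<kappa>: "0 < \<kappa>" "\<kappa> \<le> 1 / 9" "\<kappa> \<le> \<theta> / 100" unfolding \<kappa>_def using \<theta> \<theta>2 by linarith+
  have main: "\<exists>P. arith_prog P \<and> B \<subseteq> P \<and> card P \<le> m / 2 + \<eta> * m"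
    if m: "m0 \<le> m" and fin: "finite B" "finite D" and D: "card D \<le> m"
      and B: "\<And>x. x \<in> B \<Longrightarrow> card {y \<in> B. x + y \<notin> D} \<le> \<kappa> * m"
      and big: "(1 - 3 * \<kappa>) * m / 2 \<le> card B" for B D :: "int set" and m :: nat
  proof -
    define N where "N = card B"
    define xs where "xs = sorted_list_of_set B"
    have xs: "set xs = B" "length xs = N" "sorted_wrt (<) xs"
      using fin by (auto simp: xs_def N_def)
    define \<mu> where "\<mu> = nat \<lfloor>\<kappa> * m\<rfloor>"
    \<comment> \<open>The tolerance has to make up for \<open>2 * N\<close> falling short of
      \<open>m\<close> by up to \<open>3 * \<kappa> * m\<close>, for \<open>4 * \<mu>\<close>, which
      is at most \<open>4 * \<kappa> * m\<close>, and for the constant 2.\<close>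
    define w where "w = nat \<lceil>7 * \<kappa> * m\<rceil> + 2"
    have m_pos: "0 \<le> \<kappa> * m" using \<kappa> by simp
    have \<mu>: "real \<mu> \<le> \<kappa> * m" using m_pos unfolding \<mu>_def by simp
    have w: "7 * \<kappa> * m + 2 \<le> w" "w \<le> 7 * \<kappa> * m + 3"
      using m_pos unfolding w_def by linarith+
    have "12 \<le> \<kappa> * m"
      using m \<theta>2 by (simp add: m0_def \<kappa>_def field_simps)
    have "(1 - 3 * \<kappa>) * m \<ge> 2 / 3 * m" using \<kappa> by (intro mult_right_mono) auto
    then have N: "real m \<le> 3 * N" using big by (simp add: N_def)
    have "100 \<le> \<theta>\<^sup>2 * N"
    proof -
      have "300 \<le> \<theta>\<^sup>2 * m" using m \<theta>2 by (simp add: m0_def field_simps)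
      also have "\<dots> \<le> \<theta>\<^sup>2 * (3 * N)" using N \<theta>2 by (intro mult_left_mono) auto
      finally show ?thesis by (simp add: mult.commute)
    qed
    note \<theta>N = this
    have "\<theta>\<^sup>2 * N \<le> \<theta> / 100 * N" using \<theta>2 by (intro mult_right_mono) auto
    then have \<theta>N': "100 * (\<theta>\<^sup>2 * N) \<le> \<theta> * N" by simp
    have "\<theta> * N \<le> 1/100 * N" using \<theta> by (intro mult_right_mono) auto
    then have \<theta>N'': "100 * (\<theta> * N) \<le> N" by simp
    \<comment> \<open>The denominator 24 in \<open>\<kappa>\<close> is the product of this 8 and the
      3 in \<open>m \<le> 3 * N\<close>.\<close>
    have "w \<le> 8 * \<kappa> * m" using w(2) \<open>12 \<le> \<kappa> * m\<close> by simp
    also have "\<dots> \<le> 8 * \<kappa> * (3 * N)" using N \<kappa> by (intro mult_left_mono) auto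
    also have "\<dots> = \<theta>\<^sup>2 * N" by (simp add: \<kappa>_def)
    finally have w_le: "w \<le> \<theta>\<^sup>2 * N" .
    interpret almost_closed_sums "\<lambda>i. xs ! i" N D \<mu> w
    proof
      show "xs ! i < xs ! j" if "i < j" "j < N" for i j
        using sorted_wrt_nth_less[OF xs(3)] that xs(2) by simp
      show "finite D" by (rule fin)
      show "card {j. j < N \<and> xs ! i + xs ! j \<notin> D} \<le> \<mu>" if "i < N" for i
      proof -
        have "xs ! i \<in> B" using that xs by (metis nth_mem)
        have "inj_on ((!) xs) {j. j < N \<and> xs ! i + xs ! j \<notin> D}"
          using xs(2,3) by (auto simp: inj_on_def nth_eq_iff_index_eq strict_sorted_iff)
        moreover have "(!) xs ` {j. j < N \<and> xs ! i + xs ! j \<notin> D} \<subseteq> {y \<in> B. xs ! i + y \<notin> D}"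
          using xs by auto
        ultimately have "card {j. j < N \<and> xs ! i + xs ! j \<notin> D} \<le> card {y \<in> B. xs ! i + y \<notin> D}"
          using fin by (intro card_inj_on_le) auto
        also have "\<dots> \<le> \<mu>" using B[OF \<open>xs ! i \<in> B\<close>] unfolding \<mu>_def by linarith
        finally show ?thesis .
      qed
      have "real (card D + 4 * \<mu> + 2) \<le> m + 4 * \<kappa> * m + 2" using D \<mu> by simp
      also have "\<dots> \<le> 2 * N + w" using w(1) big by (simp add: N_def algebra_simps)
      finally show "card D + 4 * \<mu> + 2 \<le> 2 * N + w" by linarith
    qed
    have B_eq: "almost_closed_sums.B ((!) xs) N = B"
      using xs(1,2) unfolding B_def by (auto simp: set_conv_nth)
    define H where "H = nat \<lceil>\<theta> * N\<rceil>"
    define J where "J = nat \<lceil>N / (real H - real w)\<rceil>"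
    have H: "\<theta> * N \<le> H" "H \<le> \<theta> * N + 1" unfolding H_def using mult_nonneg_nonneg[of \<theta> "real N"] \<theta>(1) by linarith+
    have "w < H" using H w_le \<theta>N \<theta>N' by linarith
    have "real (2 * (H + 2 * w)) < N" using H w_le \<theta>N \<theta>N' \<theta>N'' by simp
    then have small: "2 * (H + 2 * w) < N" by linarith
    have "N / (real H - real w) \<le> J" unfolding J_def by linarith
    then have "real N \<le> J * (real H - real w)" using \<open>w < H\<close> by (simp add: field_simps)
    then have "real N \<le> real (J * (H - w))" using \<open>w < H\<close> by (simp add: of_nat_diff)
    then have J: "N \<le> J * (H - w)" by (simp only: of_nat_le_iff)
    obtain P K where P: "arith_prog P" "B \<subseteq> P" "card P = J * (K + 1) + 1"
      and K: "K * (N - (H + 2 * w)) \<le> N * H"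
      using subset_arith_prog[OF \<open>w < H\<close> small J] unfolding B_eq by blast
    have N_pos: "0 < real N" using small by simp
    have J_le: "\<theta> * J \<le> 1 + 3 * \<theta>"
    proof -
      have "0 \<le> N / (real H - real w)" using \<open>w < H\<close> by simp
      then have "real J < N / (real H - real w) + 1" unfolding J_def by linarith
      moreover have "N / (real H - real w) \<le> N / (\<theta> * N * (1 - \<theta>))"
      proof (rule divide_left_mono)
        show "\<theta> * N * (1 - \<theta>) \<le> real H - real w"
          using H w_le by (simp add: algebra_simps power2_eq_square)
        show "0 < (real H - real w) * (\<theta> * N * (1 - \<theta>))"
          using \<theta> N_pos \<open>w < H\<close> by (intro mult_pos_pos) auto
      qed auto
      moreover have "N / (\<theta> * N * (1 - \<theta>)) = 1 / (\<theta> * (1 - \<theta>))" using N_pos by simp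
      ultimately have "\<theta> * J \<le> \<theta> * (1 / (\<theta> * (1 - \<theta>)) + 1)" using \<theta> by (intro mult_left_mono) auto
      also have "\<dots> = 1 / (1 - \<theta>) + \<theta>" using \<theta> by (simp add: field_simps)
      also have "1 / (1 - \<theta>) \<le> 1 + 2 * \<theta>"
      proof -
        have "1 \<le> (1 + 2 * \<theta>) * (1 - \<theta>)" using \<theta> \<theta>2 by (simp add: algebra_simps power2_eq_square)
        then show ?thesis using \<theta> by (simp add: divide_le_eq)
      qed
      finally show ?thesis by simp
    qed
    have K_le: "real K + 1 \<le> \<theta> * N * (1 + 4 * \<theta>)"
    proof -
      have "(1 - 2 * \<theta>) * N \<le> real N - (real H + 2 * real w)"
        using H w_le \<theta>N \<theta>N' by (simp add: algebra_simps)
      then have "K * ((1 - 2 * \<theta>) * N) \<le> K * (real N - (real H + 2 * real w))" by (intro mult_left_mono) auto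
      also have "\<dots> = real (K * (N - (H + 2 * w)))" using small by (simp add: of_nat_diff)
      also have "\<dots> \<le> real (N * H)" using K by (simp only: of_nat_le_iff)
      finally have "K * (1 - 2 * \<theta>) \<le> H" using N_pos by (simp add: mult_ac)
      also have "\<dots> \<le> \<theta> * N + 1" by (rule H)
      finally have "K * (1 - 2 * \<theta>) * (1 + 3 * \<theta>) \<le> (\<theta> * N + 1) * (1 + 3 * \<theta>)"
        using \<theta> by (intro mult_right_mono) auto
      moreover have "real K * 1 \<le> real K * ((1 - 2 * \<theta>) * (1 + 3 * \<theta>))"
        using \<theta> \<theta>2 by (intro mult_left_mono) (auto simp: algebra_simps power2_eq_square)
      ultimately have "real K \<le> (\<theta> * N + 1) * (1 + 3 * \<theta>)" by (simp add: mult_ac)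
      then show ?thesis using \<theta>N \<theta> by (simp add: algebra_simps power2_eq_square)
    qed
    have "J * (real K + 1) \<le> J * (\<theta> * N * (1 + 4 * \<theta>))" using K_le by (intro mult_left_mono) auto
    also have "\<dots> = \<theta> * J * (N * (1 + 4 * \<theta>))" by simp
    also have "\<dots> \<le> (1 + 3 * \<theta>) * (N * (1 + 4 * \<theta>))" using J_le \<theta> by (intro mult_right_mono) auto
    also have "\<dots> = N + 7 * (\<theta> * N) + 12 * (\<theta>\<^sup>2 * N)" by (simp add: algebra_simps power2_eq_square)
    finally have "J * (real K + 1) \<le> N + 7 * (\<theta> * N) + 12 * (\<theta>\<^sup>2 * N)" .
    moreover have "real (card P) = J * (real K + 1) + 1" unfolding P(3) by (simp add: algebra_simps)
    ultimately have "real (card P) \<le> N + 8 * (\<theta> * N)" using \<theta>N \<theta>N' by linarith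
    moreover have "2 * real N \<le> m + 3 * (\<kappa> * m)"
      using card_D_lower N_pos D \<mu> \<open>12 \<le> \<kappa> * m\<close> by linarith
    moreover have "\<kappa> * m \<le> \<theta> / 100 * m" using \<kappa> by (intro mult_right_mono) auto
    then have "100 * (\<kappa> * m) \<le> \<theta> * m" "0 \<le> \<theta> * m" using \<theta> by simp_all
    moreover have "\<theta> * N \<le> \<theta> * m"
    proof -
      have "\<kappa> * m \<le> 1/9 * m" using \<kappa> by (intro mult_right_mono) auto
      then have "N \<le> real m" using \<open>2 * real N \<le> m + 3 * (\<kappa> * m)\<close> by simp
      then show ?thesis using \<theta> by (intro mult_left_mono) auto
    qed
    moreover have "9 * \<theta> * m \<le> \<eta> * m" using \<theta> assms by (intro mult_right_mono) (auto simp: \<theta>_def)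
    then have "9 * (\<theta> * m) \<le> \<eta> * m" by simp
    ultimately have "real (card P) \<le> m / 2 + \<eta> * m" by linarith
    with P show ?thesis by blast
  qed
  show thesis by (rule that[OF \<kappa>(1,2) main])
qed

section \<open>Containers\<close>

lemma exists_max_card_member:
  assumes "finite \<S>" "\<S> \<noteq> {}"
  obtains S where "S \<in> \<S>" "\<And>S'. S' \<in> \<S> \<Longrightarrow> card S' \<le> card S"
proof -
  have "Max (card ` \<S>) \<in> card ` \<S>" using assms by (intro Max_in) auto
  then obtain S where "S \<in> \<S>" "card S = Max (card ` \<S>)" by force
  with assms(1) show thesis by (intro that[of S]) auto
qed

text \<open>\<open>S\<close> has maximal size among the sets whose representation counts, capped at \<open>R\<close>, sum up to at
  least \<open>\<theta> * card T * card S\<close>. The capped sum is at most \<open>R * card (A + A)\<close>, so \<open>S\<close> is small; by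
  maximality no further element of \<open>A\<close> contributes many new sums.\<close>

lemma exists_saturating_subset:
  fixes A T :: "int set" and \<theta> :: real
  assumes "finite A" "T \<subseteq> A" "card (A + A) \<le> m"
  obtains S where "S \<subseteq> A" "\<theta> * real (card T) * real (card S) \<le> real R * real m"
    "\<And>x. x \<in> A - S \<Longrightarrow> card {t \<in> T. card {\<sigma> \<in> S. x + t - \<sigma> \<in> T} < R} \<le> \<theta> * card T"
proof -
  define r where "r S z = card {\<sigma> \<in> S. z - \<sigma> \<in> T}" for S and z :: int
  define \<Phi> where "\<Phi> S = (\<Sum>z\<in>A + A. min (r S z) R)" for S
  define \<S> where "\<S> = {S. S \<subseteq> A \<and> \<theta> * card T * card S \<le> \<Phi> S}"
  have fin: "finite (A + A)" using assms(1) by (rule finite_set_plus) (rule assms(1))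
  have "finite \<S>" by (rule finite_subset[of _ "Pow A"]) (auto simp: \<S>_def assms(1))
  moreover have "{} \<in> \<S>" by (simp add: \<S>_def)
  ultimately obtain S where S: "S \<in> \<S>" "\<And>S'. S' \<in> \<S> \<Longrightarrow> card S' \<le> card S"
    using exists_max_card_member by blast
  have SA: "S \<subseteq> A" "finite S" using S(1) assms(1) by (auto simp: \<S>_def intro: finite_subset)
  have "\<Phi> S \<le> card (A + A) * R" unfolding \<Phi>_def using sum_bounded_above[of "A + A" "\<lambda>z. min (r S z) R" R] by simp
  also have "\<dots> \<le> R * m" using assms(3) by (simp add: mult.commute)
  finally have "real (\<Phi> S) \<le> R * m" using of_nat_mono by blast
  then have size: "\<theta> * card T * card S \<le> real R * real m" using S(1) by (auto simp: \<S>_def)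
  have new: "card {t \<in> T. r S (x + t) < R} \<le> \<theta> * card T" if x: "x \<in> A - S" for x
  proof -
    let ?S = "insert x S" and ?U = "{z \<in> A + A. z - x \<in> T \<and> r S z < R}"
    have step: "min (r S z) R + (if z - x \<in> T \<and> r S z < R then 1 else 0) \<le> min (r ?S z) R" for z
    proof (cases "z - x \<in> T")
      case True
      then have "{\<sigma> \<in> ?S. z - \<sigma> \<in> T} = insert x {\<sigma> \<in> S. z - \<sigma> \<in> T}" by auto
      then have "r ?S z = Suc (r S z)" using x SA unfolding r_def by auto
      then show ?thesis by auto
    next
      case False
      then have "{\<sigma> \<in> ?S. z - \<sigma> \<in> T} = {\<sigma> \<in> S. z - \<sigma> \<in> T}" by auto
      then show ?thesis using False unfolding r_def by auto
    qed
    have "\<Phi> S + card ?U = (\<Sum>z\<in>A + A. min (r S z) R + (if z - x \<in> T \<and> r S z < R then 1 else 0))"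
      unfolding \<Phi>_def sum.distrib using fin by (simp add: sum.If_cases Int_def)
    also have "\<dots> \<le> \<Phi> ?S" unfolding \<Phi>_def by (intro sum_mono step)
    finally have "\<Phi> S + card ?U \<le> \<Phi> ?S" .
    moreover have "card ((\<lambda>t. x + t) ` {t \<in> T. r S (x + t) < R}) \<le> card ?U"
      using fin x assms(2) by (intro card_mono) auto
    then have "card {t \<in> T. r S (x + t) < R} \<le> card ?U" by (simp add: card_image)
    moreover have "\<Phi> ?S < \<theta> * card T * (card S + 1)"
    proof (rule ccontr)
      assume "\<not> ?thesis"
      then have "?S \<in> \<S>" using x SA by (auto simp: \<S>_def)
      from S(2)[OF this] show False using x SA by auto
    qed
    moreover have "\<theta> * card T * card S \<le> \<Phi> S" using S(1) by (auto simp: \<S>_def)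
    ultimately show ?thesis by (simp add: algebra_simps)
  qed
  show thesis by (rule that[OF SA(1) size]) (use new in \<open>simp add: r_def\<close>)
qed

text \<open>The set is determined by \<open>T\<close> and \<open>S\<close>, so recording these two
  small sets records a superset of \<open>A\<close>. Asking for half of \<open>T\<close>, rather
  than for one element, keeps its size within a constant factor of
  \<open>card (S + T)\<close>.\<close>

definition popular :: "int set \<Rightarrow> int set \<Rightarrow> int set" where
  "popular T S = {x. card T \<le> 2 * card {t \<in> T. x + t \<in> S + T}}"

text \<open>The case \<theta> = 1/2, \<open>R = 1\<close> of
  \<open>exists_saturating_subset\<close>: an element of \<open>A\<close> outside \<open>S\<close>
  creates new sums with at most half of \<open>T\<close>, so the other half already lands in
  \<open>S + T\<close>.\<close>

lemma exists_covering_subset: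
  fixes A T :: "int set"
  assumes "finite A" "T \<subseteq> A" "card (A + A) \<le> m"
  obtains S where "S \<subseteq> A" "card T * card S \<le> 2 * m" "A \<subseteq> popular T S"
proof -
  have T: "finite T" using assms finite_subset by blast
  obtain S where S: "S \<subseteq> A" "1/2 * card T * card S \<le> 1 * m"
    "\<And>x. x \<in> A - S \<Longrightarrow> card {t \<in> T. card {\<sigma> \<in> S. x + t - \<sigma> \<in> T} < 1} \<le> 1/2 * card T"
    using exists_saturating_subset[OF assms, of "1/2" 1] by auto
  have fin: "finite S" using S(1) assms(1) finite_subset by blast
  have "x \<in> popular T S" if "x \<in> A" for x
  proof (cases "x \<in> S")
    case True
    then have "{t \<in> T. x + t \<in> S + T} = T" by auto
    then show ?thesis by (simp add: popular_def)
  next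
    case False
    have "{t \<in> T. x + t \<notin> S + T} \<subseteq> {t \<in> T. card {\<sigma> \<in> S. x + t - \<sigma> \<in> T} < 1}"
    proof (rule subsetI)
      fix t assume "t \<in> {t \<in> T. x + t \<notin> S + T}"
      then have t: "t \<in> T" "x + t \<notin> S + T" by simp_all
      have False if "\<sigma> \<in> S" "x + t - \<sigma> \<in> T" for \<sigma>
        using t(2) set_plus_intro[OF that] by simp
      then have "{\<sigma> \<in> S. x + t - \<sigma> \<in> T} = {}" by auto
      then have "card {\<sigma> \<in> S. x + t - \<sigma> \<in> T} < 1" by (metis card.empty less_one)
      then show "t \<in> {t \<in> T. card {\<sigma> \<in> S. x + t - \<sigma> \<in> T} < 1}" using t by simp
    qed
    then have "card {t \<in> T. x + t \<notin> S + T} \<le> card {t \<in> T. card {\<sigma> \<in> S. x + t - \<sigma> \<in> T} < 1}"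
      using T by (intro card_mono) auto
    with S(3)[of x] that False have "2 * card {t \<in> T. x + t \<notin> S + T} \<le> card T" by auto
    moreover have "{t \<in> T. x + t \<in> S + T} = T - {t \<in> T. x + t \<notin> S + T}" by auto
    then have "card {t \<in> T. x + t \<in> S + T} = card T - card {t \<in> T. x + t \<notin> S + T}"
      using T by (simp add: card_Diff_subset)
    ultimately show ?thesis by (simp add: popular_def)
  qed
  then have "A \<subseteq> popular T S" by auto
  moreover have "real (card T * card S) \<le> real (2 * m)" using S(2) by simp
  then have "card T * card S \<le> 2 * m" by (simp only: of_nat_le_iff)
  ultimately show thesis using that S(1) by blast
qed

text \<open>Double counting of the pairs (x, t) with \<open>x + t\<close> in \<open>S + T\<close>:
  every \<open>x\<close> has at least half of \<open>T\<close> as partners, every \<open>t\<close>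
  has at most \<open>card (S + T)\<close>. Finiteness holds because every \<open>x\<close> is a
  difference \<open>z - t\<close>.\<close>

lemma popular_bounds:
  assumes "finite T" "T \<noteq> {}" "finite S"
  shows "finite (popular T S)" "card (popular T S) \<le> 2 * card (S + T)"
proof -
  let ?D = "S + T"
  have D: "finite ?D" using assms by (simp add: finite_set_plus)
  have "popular T S \<subseteq> (\<lambda>(z, t). z - t) ` (?D \<times> T)"
  proof
    fix x assume "x \<in> popular T S"
    then have "card T \<le> 2 * card {t \<in> T. x + t \<in> ?D}" by (simp add: popular_def)
    moreover have "0 < card T" using assms by (simp add: card_gt_0_iff)
    ultimately have "0 < card {t \<in> T. x + t \<in> ?D}" by linarith
    then obtain t where "t \<in> T" "x + t \<in> ?D" by (auto simp: card_gt_0_iff)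
    then show "x \<in> (\<lambda>(z, t). z - t) ` (?D \<times> T)" by (intro image_eqI[of _ _ "(x + t, t)"]) auto
  qed
  then show fin: "finite (popular T S)" using D assms finite_subset by blast
  have "card (popular T S) * card T = (\<Sum>x\<in>popular T S. card T)" by simp
  also have "\<dots> \<le> (\<Sum>x\<in>popular T S. 2 * card {t \<in> T. x + t \<in> ?D})"
    by (rule sum_mono) (simp add: popular_def)
  also have "\<dots> = 2 * (\<Sum>t\<in>T. card {x \<in> popular T S. x + t \<in> ?D})"
    using sum_card_filter_swap[OF fin assms(1), of "\<lambda>x t. x + t \<in> ?D"] by (simp flip: sum_distrib_left)
  also have "\<dots> \<le> 2 * (\<Sum>t\<in>T. card ?D)"
  proof -
    have "card {x \<in> popular T S. x + t \<in> ?D} \<le> card ?D" for t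
      by (rule card_inj_on_le[of "\<lambda>x. x + t"]) (use D in auto)
    then show ?thesis by (intro mult_left_mono sum_mono) auto
  qed
  finally have "card (popular T S) * card T \<le> 2 * card ?D * card T" by (simp add: mult_ac)
  then show "card (popular T S) \<le> 2 * card ?D" using assms by (auto simp: card_gt_0_iff)
qed

section \<open>A small set whose sums include most sums of pairs\<close>

lemma exists_hitting_set:
  fixes N :: "'i \<Rightarrow> 'a set"
  assumes "finite A" "A \<noteq> {}" "finite I" "R \<le> card A"
    and N: "\<And>i. i \<in> I \<Longrightarrow> N i \<subseteq> A" "\<And>i. i \<in> I \<Longrightarrow> R \<le> card (N i)"
  shows "\<exists>T \<subseteq> A. card T \<le> t \<and> card {i \<in> I. N i \<inter> T = {}} \<le> card I * (1 - R / card A) ^ t"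
proof (induction t)
  case 0
  then show ?case by (intro exI[of _ "{}"]) auto
next
  case (Suc t)
  then obtain T where T: "T \<subseteq> A" "card T \<le> t"
    "card {i \<in> I. N i \<inter> T = {}} \<le> card I * (1 - R / card A) ^ t" by auto
  let ?U = "{i \<in> I. N i \<inter> T = {}}"
  have fin: "finite ?U" using assms(3) by auto
  have s: "0 < card A" using assms by (auto simp: card_gt_0_iff)
  \<comment> \<open>Greedy choice: by averaging, some \<open>a\<close> lies in at least a proportion
    \<open>R / card A\<close> of the sets not hit so far.\<close>
  have "\<exists>a\<in>A. R * card ?U \<le> card A * card {i \<in> ?U. a \<in> N i}"
  proof (rule ccontr)
    assume *: "\<not> ?thesis"
    have "card A * (\<Sum>i\<in>?U. card {a \<in> A. a \<in> N i}) = (\<Sum>a\<in>A. card A * card {i \<in> ?U. a \<in> N i})"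
      using sum_card_filter_swap[OF assms(1) fin, of "\<lambda>a i. a \<in> N i"] by (simp flip: sum_distrib_left)
    also have "\<dots> < (\<Sum>a\<in>A. R * card ?U)"
      using * assms by (intro sum_strict_mono) (auto simp: not_le)
    also have "\<dots> = card A * (R * card ?U)" by simp
    finally have "(\<Sum>i\<in>?U. card {a \<in> A. a \<in> N i}) < R * card ?U" by simp
    moreover have "(\<Sum>i\<in>?U. R) \<le> (\<Sum>i\<in>?U. card {a \<in> A. a \<in> N i})"
    proof (rule sum_mono)
      fix i assume i: "i \<in> ?U"
      then have "{a \<in> A. a \<in> N i} = N i" using N(1)[of i] by auto
      then show "R \<le> card {a \<in> A. a \<in> N i}" using N(2)[of i] i by auto
    qed
    ultimately show False by (simp add: mult_ac)
  qed
  then obtain a where a: "a \<in> A" "R * card ?U \<le> card A * card {i \<in> ?U. a \<in> N i}" by auto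
  have eq: "{i \<in> I. N i \<inter> insert a T = {}} = ?U - {i \<in> ?U. a \<in> N i}" by auto
  have fin': "finite {i \<in> ?U. a \<in> N i}" by (rule finite_subset[OF _ fin]) auto
  have "card {i \<in> ?U. a \<in> N i} \<le> card ?U" using fin by (intro card_mono) auto
  then have "real (card {i \<in> I. N i \<inter> insert a T = {}}) = real (card ?U) - real (card {i \<in> ?U. a \<in> N i})"
    unfolding eq using fin' by (subst card_Diff_subset) (auto simp: of_nat_diff)
  also have "\<dots> \<le> card ?U * (1 - R / card A)"
  proof -
    have "real (R * card ?U) \<le> real (card A * card {i \<in> ?U. a \<in> N i})"
      using a(2) by (simp only: of_nat_le_iff)
    then show ?thesis using s by (simp add: field_simps)
  qed
  also have "\<dots> \<le> (card I * (1 - R / card A) ^ t) * (1 - R / card A)"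
    using T(3) assms(4) s by (intro mult_right_mono) (auto simp: field_simps)
  finally have "real (card {i \<in> I. N i \<inter> insert a T = {}}) \<le> card I * (1 - R / card A) ^ Suc t"
    by (simp add: mult_ac)
  moreover have "card (insert a T) \<le> Suc t"
    using T(2) card_insert_le_m1[of "Suc t" T a] by simp
  ultimately show ?case using T(1) a(1) by (intro exI[of _ "insert a T"]) auto
qed

text \<open>\<open>F\<close> is the union of a set \<open>S\<close> that saturates \<open>A\<close>
  and a hitting set \<open>T\<close>. The sum of a pair (x, y) can be missed only if
  \<open>x\<close> is in \<open>S\<close>, or if \<open>x + y\<close> has fewer than
  \<open>R\<close> representations as an element of \<open>S\<close> plus one of \<open>A\<close>,
  or if \<open>T\<close> avoids the second summands of all these representations. The three terms of
  the bound count these cases.\<close>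

lemma exists_small_basis:
  fixes A :: "int set" and \<theta> :: real
  assumes "finite A" "A \<noteq> {}" "card (A + A) \<le> m" "0 < \<theta>" "R \<le> card A"
  obtains F where "F \<subseteq> A" "real (card F) \<le> real t + real R * real m / (\<theta> * real (card A))"
    "real (card {(x, y) \<in> A \<times> A. x + y \<notin> F + F})
      \<le> real R * real m / \<theta> + \<theta> * (real (card A))\<^sup>2 + (real (card A))\<^sup>2 * (1 - real R / real (card A)) ^ t"
proof -
  have s: "0 < card A" using assms by (auto simp: card_gt_0_iff)
  obtain S where S: "S \<subseteq> A" "\<theta> * card A * card S \<le> R * m"
    "\<And>x. x \<in> A - S \<Longrightarrow> card {t \<in> A. card {\<sigma> \<in> S. x + t - \<sigma> \<in> A} < R} \<le> \<theta> * card A"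
    using exists_saturating_subset[OF assms(1) order_refl assms(3), of \<theta> R] by auto
  define r where "r i = card {\<sigma> \<in> S. fst i + snd i - \<sigma> \<in> A}" for i
  define N where "N i = {c \<in> A. fst i + snd i - c \<in> S}" for i
  define I where "I = {i \<in> A \<times> A. R \<le> r i}"
  have card_N: "card (N i) = r i" for i
  proof -
    have "bij_betw (\<lambda>c. fst i + snd i - c) (N i) {\<sigma> \<in> S. fst i + snd i - \<sigma> \<in> A}"
      by (rule bij_betwI[where g = "\<lambda>c. fst i + snd i - c"]) (use S(1) in \<open>auto simp: N_def\<close>)
    then show ?thesis unfolding r_def by (rule bij_betw_same_card)
  qed
  have I: "finite I" "card I \<le> (card A)\<^sup>2"
    using assms(1) card_mono[of "A \<times> A" I] by (auto simp: I_def card_cartesian_product power2_eq_square)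
  have "\<exists>T \<subseteq> A. card T \<le> t \<and> card {i \<in> I. N i \<inter> T = {}} \<le> card I * (1 - R / card A) ^ t"
    by (rule exists_hitting_set) (use assms I card_N in \<open>auto simp: N_def I_def\<close>)
  then obtain T where T: "T \<subseteq> A" "card T \<le> t"
    "card {i \<in> I. N i \<inter> T = {}} \<le> card I * (1 - R / card A) ^ t" by auto
  have cS: "real (card S) \<le> real R * real m / (\<theta> * real (card A))"
    using S(2) s assms(4) by (simp add: field_simps)
  have fin: "finite S" "finite T" using S T assms(1) finite_subset by blast+
  show thesis
  proof (rule that[of "S \<union> T"])
    show "S \<union> T \<subseteq> A" using S T by auto
    have "real (card (S \<union> T)) \<le> real (card S) + real (card T)"
      using card_Un_le[of S T] by linarith
    then show "real (card (S \<union> T)) \<le> real t + real R * real m / (\<theta> * real (card A))"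
      using T(2) cS by simp
    let ?M = "{(x, y) \<in> A \<times> A. x + y \<notin> (S \<union> T) + (S \<union> T)}"
    let ?W = "Sigma (A - S) (\<lambda>x. {y \<in> A. card {\<sigma> \<in> S. x + y - \<sigma> \<in> A} < R})"
    have "?M \<subseteq> S \<times> A \<union> ?W \<union> {i \<in> I. N i \<inter> T = {}}"
    proof (rule subsetI, rule ccontr)
      fix i assume "i \<in> ?M" and i: "i \<notin> S \<times> A \<union> ?W \<union> {i \<in> I. N i \<inter> T = {}}"
      then obtain x y where xy: "i = (x, y)" "x \<in> A" "y \<in> A" "x + y \<notin> (S \<union> T) + (S \<union> T)" by blast
      with i have "i \<in> I" by (auto simp: I_def r_def)
      with i have "N i \<inter> T \<noteq> {}" by blast
      with xy(1) obtain c where "c \<in> T" "x + y - c \<in> S" by (auto simp: N_def)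
      then have "(x + y - c) + c \<in> (S \<union> T) + (S \<union> T)" by (intro set_plus_intro) auto
      with xy(4) show False by simp
    qed
    moreover have "finite (S \<times> A \<union> ?W \<union> {i \<in> I. N i \<inter> T = {}})"
      using fin(1) assms(1) I(1) by (intro finite_UnI finite_SigmaI) simp_all
    ultimately have "card ?M \<le> card (S \<times> A \<union> ?W \<union> {i \<in> I. N i \<inter> T = {}})"
      by (rule card_mono[rotated])
    also have "\<dots> \<le> card (S \<times> A) + card ?W + card {i \<in> I. N i \<inter> T = {}}"
      by (meson add_mono card_Un_le le_trans order_refl)
    finally have "real (card ?M) \<le> real (card (S \<times> A)) + real (card ?W) + real (card {i \<in> I. N i \<inter> T = {}})"
      by linarith
    also have "real (card (S \<times> A)) \<le> real R * real m / \<theta>"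
      using S(2) assms(4) by (simp add: card_cartesian_product field_simps)
    also have "real (card ?W) \<le> \<theta> * (real (card A))\<^sup>2"
    proof -
      have "real (card ?W) = (\<Sum>x\<in>A - S. real (card {y \<in> A. card {\<sigma> \<in> S. x + y - \<sigma> \<in> A} < R}))"
        using assms(1) by (subst card_SigmaI) auto
      also have "\<dots> \<le> (\<Sum>x\<in>A - S. \<theta> * card A)" by (rule sum_mono) (rule S(3))
      also have "\<dots> = card (A - S) * (\<theta> * card A)" by simp
      also have "\<dots> \<le> card A * (\<theta> * card A)"
        using assms by (intro mult_right_mono of_nat_mono card_mono) auto
      finally show ?thesis by (simp add: power2_eq_square mult_ac)
    qed
    also have "real (card {i \<in> I. N i \<inter> T = {}}) \<le> (real (card A))\<^sup>2 * (1 - real R / real (card A)) ^ t"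
    proof -
      have "real (card I) \<le> (real (card A))\<^sup>2" using I(2) by (metis of_nat_le_iff of_nat_power)
      then have "real (card I) * (1 - R / card A) ^ t \<le> (real (card A))\<^sup>2 * (1 - real R / real (card A)) ^ t"
        using assms(5) s by (intro mult_right_mono zero_le_power) (auto simp: field_simps)
      with T(3) show ?thesis by linarith
    qed
    finally show "real (card ?M) \<le> real R * real m / \<theta> + \<theta> * (real (card A))\<^sup>2
        + (real (card A))\<^sup>2 * (1 - real R / real (card A)) ^ t"
      by simp
  qed
qed

section \<open>Kleitman-Winston containers in the graph joining \<open>x\<close> and
  \<open>y\<close> when \<open>x + y \<in> D\<close>\<close>

definition common_nbrs :: "int set \<Rightarrow> int set \<Rightarrow> int set \<Rightarrow> int set" where
  "common_nbrs X D V = {x \<in> X. \<forall>v\<in>V. x + v \<in> D}"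

text \<open>A vertex with more than \<open>e\<close> non-neighbours among the surviving vertices
  would, if put into \<open>V\<close>, remove more than \<open>e\<close> of them. The container
  keeps the survivors for which this is not so.\<close>

definition container :: "int set \<Rightarrow> int set \<Rightarrow> int set \<Rightarrow> nat \<Rightarrow> int set" where
  "container X D V e =
    {x \<in> common_nbrs X D V. card {y \<in> common_nbrs X D V. x + y \<notin> D} \<le> e}"

text \<open>\<open>V\<close> is a largest set of elements with at most \<open>q\<close> missing
  partners in \<open>A\<close>, subject to removing at least \<open>e\<close> vertices per element.
  By maximality all such elements that survive are in the container. The losses are the elements
  with more than \<open>q\<close> missing partners, at most \<open>M / q\<close> by Markov, and at
  most \<open>q\<close> elements for each member of \<open>V\<close>.\<close>

lemma exists_container:
  fixes A X D :: "int set" and q M :: real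
  assumes "finite X" "A \<subseteq> X" "0 < q" "card {(x, y) \<in> A \<times> A. x + y \<notin> D} \<le> M"
  obtains V where "V \<subseteq> A" "e * card V \<le> card X"
    "card (A - container X D V e) \<le> M / q + card V * q"
proof -
  define A' where "A' = {x \<in> A. card {y \<in> A. x + y \<notin> D} \<le> q}"
  define \<V> where "\<V> = {V. V \<subseteq> A' \<and> e * card V + card (common_nbrs X D V) \<le> card X}"
  have fin: "finite A" using assms(1,2) finite_subset by blast
  then have "finite A'" by (simp add: A'_def)
  have "finite \<V>" by (rule finite_subset[of _ "Pow A'"]) (auto simp: \<V>_def \<open>finite A'\<close>)
  moreover have "{} \<in> \<V>" by (simp add: \<V>_def common_nbrs_def)
  ultimately obtain V where V: "V \<in> \<V>" "\<And>V'. V' \<in> \<V> \<Longrightarrow> card V' \<le> card V"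
    using exists_max_card_member by blast
  let ?B = "common_nbrs X D V"
  have VA: "V \<subseteq> A'" "finite V" using V(1) \<open>finite A'\<close> finite_subset by (auto simp: \<V>_def)
  have "x \<in> container X D V e" if x: "x \<in> A'" "x \<in> ?B" for x
  proof (cases "x \<in> V")
    case True
    then have "{y \<in> ?B. x + y \<notin> D} = {}" by (auto simp: common_nbrs_def add.commute)
    then have "card {y \<in> ?B. x + y \<notin> D} = 0" by (metis card.empty)
    then show ?thesis using x by (simp add: container_def)
  next
    case False
    have "insert x V \<notin> \<V>" using V(2)[of "insert x V"] False VA by auto
    then have "card X < e * Suc (card V) + card (common_nbrs X D (insert x V))"
      using x VA False by (auto simp: \<V>_def)
    moreover have "common_nbrs X D (insert x V) = ?B - {y \<in> ?B. x + y \<notin> D}"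
      by (auto simp: common_nbrs_def add.commute)
    moreover have "finite ?B" using assms(1) by (simp add: common_nbrs_def)
    ultimately have "card X < e * Suc (card V) + (card ?B - card {y \<in> ?B. x + y \<notin> D})"
      by (simp add: card_Diff_subset)
    moreover have "card {y \<in> ?B. x + y \<notin> D} \<le> card ?B"
      using \<open>finite ?B\<close> by (intro card_mono) auto
    moreover have "e * card V + card ?B \<le> card X" using V(1) by (simp add: \<V>_def)
    moreover have "e * Suc (card V) = e + e * card V" by simp
    ultimately have "card {y \<in> ?B. x + y \<notin> D} \<le> e" by linarith
    then show ?thesis using x by (simp add: container_def)
  qed
  then have "A - container X D V e \<subseteq> (A - A') \<union> (\<Union>v\<in>V. {y \<in> A. v + y \<notin> D})"
    using assms(2) by (auto simp: common_nbrs_def add.commute)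
  then have "card (A - container X D V e) \<le> card ((A - A') \<union> (\<Union>v\<in>V. {y \<in> A. v + y \<notin> D}))"
    using fin VA by (intro card_mono) auto
  also have "\<dots> \<le> card (A - A') + card (\<Union>v\<in>V. {y \<in> A. v + y \<notin> D})" by (rule card_Un_le)
  also have "card (\<Union>v\<in>V. {y \<in> A. v + y \<notin> D}) \<le> (\<Sum>v\<in>V. card {y \<in> A. v + y \<notin> D})"
    using VA(2) by (rule card_UN_le)
  finally have "real (card (A - container X D V e)) \<le> real (card (A - A')) + (\<Sum>v\<in>V. real (card {y \<in> A. v + y \<notin> D}))"
    unfolding of_nat_sum[symmetric] by linarith
  also have "(\<Sum>v\<in>V. real (card {y \<in> A. v + y \<notin> D})) \<le> (\<Sum>v\<in>V. q)"
    by (rule sum_mono) (use VA in \<open>auto simp: A'_def\<close>)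
  also have "(\<Sum>v\<in>V. q) = card V * q" by simp
  also have "real (card (A - A')) \<le> M / q"
  proof -
    have "card (A - A') * q = (\<Sum>x\<in>A - A'. q)" by simp
    also have "\<dots> \<le> (\<Sum>x\<in>A - A'. real (card {y \<in> A. x + y \<notin> D}))"
      by (rule sum_mono) (auto simp: A'_def)
    also have "\<dots> = card (Sigma (A - A') (\<lambda>x. {y \<in> A. x + y \<notin> D}))"
      using fin by (subst card_SigmaI) auto
    also have "\<dots> \<le> card {(x, y) \<in> A \<times> A. x + y \<notin> D}"
      using fin by (intro of_nat_mono card_mono finite_subset[of "{(x, y) \<in> A \<times> A. x + y \<notin> D}" "A \<times> A"]) auto
    finally show ?thesis using assms(3,4) by (simp add: field_simps)
  qed
  finally have "card (A - container X D V e) \<le> M / q + card V * q" by simp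
  moreover have "V \<subseteq> A" using VA by (auto simp: A'_def)
  moreover have "e * card V \<le> card X" using V(1) by (auto simp: \<V>_def)
  ultimately show thesis using that by blast
qed

section \<open>Fingerprints of sets with few sums\<close>

lemma card_sumset_mono:
  fixes A U V :: "int set"
  assumes "finite A" "U \<subseteq> A" "V \<subseteq> A"
  shows "card (U + V) \<le> card (A + A)"
  using assms by (intro card_mono finite_set_plus set_plus_mono2)

lemma card_le_card_sumset:
  fixes A :: "int set"
  assumes "finite A"
  shows "card A \<le> card (A + A)"
proof (cases "A = {}")
  case False
  then obtain a where "a \<in> A" by auto
  then show ?thesis
    using assms by (intro card_inj_on_le[of "\<lambda>x. a + x"]) (auto intro: finite_set_plus)
qed simp

text \<open>The data that encode \<open>A\<close>: \<open>T\<close> and \<open>S\<close> fix an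
  outer container, \<open>F\<close> and \<open>V\<close> refine it, and \<open>Y\<close> collects
  \<open>F\<close> and the elements of \<open>A\<close> that the inner container misses. Requiring
  \<open>F \<subseteq> Y\<close> lets \<open>F\<close> be specified by one bit per element of
  \<open>Y\<close>.\<close>

definition has_fingerprint :: "real \<Rightarrow> real \<Rightarrow> nat \<Rightarrow> nat \<Rightarrow> int set \<Rightarrow> bool" where
  "has_fingerprint \<gamma> \<kappa> m t0 A \<longleftrightarrow> (\<exists>T S V Y F. T \<subseteq> A \<and> S \<subseteq> A \<and> V \<subseteq> A \<and> F \<subseteq> Y \<and> Y \<subseteq> A \<and> card T = t0 \<and> card S \<le> 2 * t0 \<and>
       real (card V) \<le> 4 / \<kappa> \<and> real (card Y) \<le> \<gamma> * real (card A) \<and> A \<subseteq> popular T S \<and>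
       A - Y \<subseteq> container (popular T S) (F + F) V (nat \<lfloor>\<kappa> * real m\<rfloor>))"

lemma exists_fingerprint:
  fixes \<gamma> \<kappa> :: real
  assumes "0 < \<gamma>" "0 < \<kappa>"
  obtains c where "0 < c"
    "\<And>A m t0. \<lbrakk>finite A; A \<noteq> {}; card (A + A) \<le> m; real m \<le> c * (real (card A))\<^sup>2; 1 \<le> c * real (card A);
       0 < t0; t0 \<le> card A; m \<le> t0 * t0\<rbrakk> \<Longrightarrow>
     has_fingerprint \<gamma> \<kappa> m t0 A"
proof -
  \<comment> \<open>Half of the allowance \<open>\<gamma> * s\<close> for \<open>Y\<close> goes to
    \<open>F\<close> and a quarter to each loss in \<open>exists_container\<close> with
    \<open>q = \<xi> * s\<close>. As \<open>card V \<le> 4 / \<kappa>\<close>, the choice of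
    \<open>\<xi>\<close> settles \<open>card V * q\<close>; that of \<open>\<theta>\<close> settles
    the other loss, with \<open>M = 3 * \<theta> * s\<^sup>2\<close>; and \<open>R\<close> makes the
    power in \<open>exists_small_basis\<close> at most \<open>\<theta>\<close> for \<open>t\<close>
    about \<open>\<gamma> / 4 * s\<close>.\<close>
  define \<xi> where "\<xi> = \<gamma> * \<kappa> / 16"
  define \<theta> where "\<theta> = \<xi> * \<gamma> / 12"
  define R where "R = nat \<lceil>8 / \<gamma> * ln (1 / \<theta>)\<rceil> + 1"
  define c where "c = Min {\<gamma> * \<theta> / (4 * R), \<theta>\<^sup>2 / R, 1 / R, \<gamma> / 8, \<kappa> / 2}"
  have pos: "0 < \<xi>" "0 < \<theta>" "0 < R" using assms by (auto simp: \<xi>_def \<theta>_def R_def)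
  have c_pos: "0 < c" using assms pos unfolding c_def by (subst Min_gr_iff) auto
  have c: "c \<le> \<gamma> * \<theta> / (4 * R)" "c \<le> \<theta>\<^sup>2 / R" "c \<le> 1 / R" "c \<le> \<gamma> / 8" "c \<le> \<kappa> / 2"
    unfolding c_def by (rule Min_le; simp)+
  have main: "has_fingerprint \<gamma> \<kappa> m t0 A"
    if A: "finite A" "A \<noteq> {}" "card (A + A) \<le> m" and m: "real m \<le> c * (real (card A))\<^sup>2"
      and s_large: "1 \<le> c * real (card A)" and t0: "0 < t0" "t0 \<le> card A" "m \<le> t0 * t0" for A m t0
  proof -
    define s where "s = card A"
    have s_pos: "0 < s" using A by (auto simp: s_def card_gt_0_iff)
    have scale: "1 \<le> d * s" if "c \<le> d" for d
    proof -
      have "c * s \<le> d * s" using that by (intro mult_right_mono) auto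
      with s_large show ?thesis by (simp add: s_def)
    qed
    have scale2: "m \<le> d * (real s)\<^sup>2" if "c \<le> d" for d
    proof -
      have "c * (real s)\<^sup>2 \<le> d * (real s)\<^sup>2" using that by (intro mult_right_mono) auto
      with m show ?thesis by (simp add: s_def)
    qed
    have sm: "s \<le> m" using card_le_card_sumset[OF A(1)] A(3) by (simp add: s_def)
    obtain T where T: "T \<subseteq> A" "card T = t0" "finite T"
      using obtain_subset_with_card_n[OF t0(2)] by blast
    obtain S where S: "S \<subseteq> A" "card T * card S \<le> 2 * m" "A \<subseteq> popular T S"
      using exists_covering_subset[OF A(1) T(1) A(3)] by blast
    have "t0 * card S \<le> 2 * m" using S(2) T(2) by simp
    also have "\<dots> \<le> t0 * (2 * t0)" using t0(3) by simp
    finally have "t0 * card S \<le> t0 * (2 * t0)" .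
    then have S_le: "card S \<le> 2 * t0" using t0(1) by simp
    have "finite S" using S(1) A(1) finite_subset by blast
    have "T \<noteq> {}" using T t0 by auto
    have "card (S + T) \<le> m" using card_sumset_mono[OF A(1) S(1) T(1)] A(3) by simp
    then have X: "finite (popular T S)" "card (popular T S) \<le> 2 * m"
      using popular_bounds[OF T(3) \<open>T \<noteq> {}\<close> \<open>finite S\<close>] by auto
    define t where "t = nat \<lfloor>\<gamma> / 4 * s\<rfloor>"
    have "1 \<le> \<gamma> / 8 * s" using c(4) by (rule scale)
    then have t: "t \<le> \<gamma> / 4 * s" "\<gamma> / 8 * s \<le> t" unfolding t_def by linarith+
    have "1 \<le> 1 / R * s" using c(3) by (rule scale)
    then have R: "R \<le> s" using pos(3) by (simp add: field_simps)
    obtain F where F: "F \<subseteq> A" "real (card F) \<le> real t + real R * real m / (\<theta> * real s)"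
      "real (card {(x, y) \<in> A \<times> A. x + y \<notin> F + F})
        \<le> real R * real m / \<theta> + \<theta> * (real s)\<^sup>2 + (real s)\<^sup>2 * (1 - real R / real s) ^ t"
      using exists_small_basis[OF A pos(2), of R t] R unfolding s_def by blast
    have F_le: "real (card F) \<le> \<gamma> / 2 * s"
    proof -
      have "m \<le> \<gamma> * \<theta> / (4 * R) * (real s)\<^sup>2" using c(1) by (rule scale2)
      then have "real R * real m / (\<theta> * real s) \<le> \<gamma> / 4 * s"
        using pos s_pos by (simp add: field_simps power2_eq_square)
      with F(2) t(1) show ?thesis by linarith
    qed
    have miss: "real (card {(x, y) \<in> A \<times> A. x + y \<notin> F + F}) \<le> 3 * \<theta> * (real s)\<^sup>2"
    proof -
      have "m \<le> \<theta>\<^sup>2 / R * (real s)\<^sup>2" using c(2) by (rule scale2)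
      then have 1: "real R * real m / \<theta> \<le> \<theta> * (real s)\<^sup>2"
        using pos by (simp add: field_simps power2_eq_square)
      have "(1 - real R / real s) ^ t \<le> exp (- (real R / real s)) ^ t"
        using R s_pos exp_ge_add_one_self[of "- (real R / real s)"] by (intro power_mono) auto
      also have "\<dots> = exp (- (R * t / s))" by (simp add: exp_of_nat_mult[symmetric])
      also have "\<dots> \<le> exp (ln \<theta>)"
      proof -
        have "ln (1 / \<theta>) = (8 / \<gamma> * ln (1 / \<theta>)) * (\<gamma> / 8)" using assms by simp
        also have "\<dots> \<le> R * (\<gamma> / 8)" using assms unfolding R_def by (intro mult_right_mono) linarith+
        also have "\<dots> \<le> R * (t / s)" using t(2) s_pos by (intro mult_left_mono) (auto simp: field_simps)
        finally have "- (R * t / s) \<le> ln \<theta>" using pos by (simp add: ln_div)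
        then show ?thesis by (subst exp_le_cancel_iff)
      qed
      also have "\<dots> = \<theta>" using pos by simp
      finally have "(real s)\<^sup>2 * (1 - real R / real s) ^ t \<le> (real s)\<^sup>2 * \<theta>" by (intro mult_left_mono) auto
      with 1 F(3) show ?thesis by (simp add: mult.commute)
    qed
    define e where "e = nat \<lfloor>\<kappa> * real m\<rfloor>"
    have "0 < \<xi> * s" using pos s_pos by simp
    then obtain V where V: "V \<subseteq> A" "e * card V \<le> card (popular T S)"
      "card (A - container (popular T S) (F + F) V e) \<le> 3 * \<theta> * (real s)\<^sup>2 / (\<xi> * s) + card V * (\<xi> * s)"
      using exists_container[OF X(1) S(3) _ miss, of "\<xi> * s" e] by blast
    have e: "\<kappa> / 2 * m \<le> e"
    proof -
      have "1 \<le> \<kappa> / 2 * s" using c(5) by (rule scale)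
      also have "\<dots> \<le> \<kappa> / 2 * m" using sm assms by (intro mult_left_mono) auto
      finally show ?thesis unfolding e_def by linarith
    qed
    \<comment> \<open>Each element of \<open>V\<close> accounts for at least
      \<open>\<kappa> / 2 * m\<close> removed vertices, out of at most \<open>2 * m\<close>.\<close>
    have V_le: "real (card V) \<le> 4 / \<kappa>"
    proof -
      have "\<kappa> / 2 * m * card V \<le> real e * real (card V)" using e by (intro mult_right_mono) auto
      also have "\<dots> = real (e * card V)" by simp
      also have "\<dots> \<le> real (2 * m)" using V(2) X(2) by (simp only: of_nat_le_iff)
      finally show ?thesis using assms sm s_pos by (simp add: field_simps)
    qed
    define Y where "Y = F \<union> (A - container (popular T S) (F + F) V e)"
    have "3 * \<theta> * (real s)\<^sup>2 / (\<xi> * s) = \<gamma> / 4 * s"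
      using pos s_pos by (simp add: \<theta>_def power2_eq_square)
    moreover have "card V * (\<xi> * s) \<le> 4 / \<kappa> * (\<xi> * s)" using V_le pos by (intro mult_right_mono) auto
    moreover have "4 / \<kappa> * (\<xi> * s) = \<gamma> / 4 * s" using assms by (simp add: \<xi>_def)
    moreover have "real (card Y) \<le> card F + card (A - container (popular T S) (F + F) V e)"
      unfolding Y_def using card_Un_le of_nat_mono by blast
    ultimately have "real (card Y) \<le> \<gamma> * real (card A)" using V(3) F_le by (simp add: s_def)
    moreover have "F \<subseteq> Y" "Y \<subseteq> A" "A - Y \<subseteq> container (popular T S) (F + F) V e"
      using F(1) by (auto simp: Y_def)
    ultimately show ?thesis using T S S_le V V_le unfolding e_def has_fingerprint_def by blast
  qed
  show thesis by (rule that[OF c_pos main])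
qed

section \<open>Counting\<close>

text \<open>The falling factorials are compared factor by factor; for \<open>j > b\<close> the left
  side vanishes.\<close>

lemma binomial_le_power_mult:
  fixes b b' j :: nat and r :: real
  assumes "\<And>i. i < j \<Longrightarrow> real b - real i \<le> r * (real b' - real i)" "0 \<le> r"
  shows "real (b choose j) \<le> r ^ j * real (b' choose j)"
proof (cases "j \<le> b")
  case True
  have "(\<Prod>i=0..<j. real b - real i) \<le> (\<Prod>i=0..<j. r * (real b' - real i))"
    using True assms(1) by (intro prod_mono) auto
  also have "\<dots> = r ^ j * (\<Prod>i=0..<j. real b' - real i)" by (simp add: prod.distrib)
  finally show ?thesis
    by (simp add: binomial_gbinomial gbinomial_prod_rev divide_right_mono)
next
  case False
  then show ?thesis using assms(2) by (simp add: binomial_eq_0)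
qed

text \<open>Reserve \<open>q\<close> of \<open>k\<close> points. Choosing \<open>y\<close> elements
  from \<open>M\<close> instead of from the reserved points costs a factor \<open>2 * M / q\<close>
  for each, as \<open>y\<close> is at most \<open>q / 2\<close>; choosing the others from
  \<open>b\<close> instead of from the \<open>k - q\<close> remaining points gains a factor
  \<open>r\<close> for each. Vandermonde bounds the product of the two new binomials by
  \<open>k choose s\<close>.\<close>

lemma binomial_product_le:
  fixes b k q s y M :: nat and r :: real
  assumes "y \<le> s" "2 * y \<le> q" "0 < q" "q \<le> k" "0 \<le> r" "r \<le> 1" "real b \<le> r * (real k - real q)"
  shows "real (M choose y) * real (b choose (s - y))
    \<le> (2 * real M / real q) ^ y * r ^ (s - y) * real (k choose s)"
proof -
  have "real (M choose y) \<le> (2 * real M / real q) ^ y * real (q choose y)"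
  proof (rule binomial_le_power_mult)
    fix i assume "i < y"
    then have "real q \<le> 2 * (real q - real i)" using assms(2) by simp
    then have "real M * q \<le> M * (2 * (real q - real i))" by (intro mult_left_mono) auto
    then have "real M \<le> 2 * real M / real q * (real q - real i)" using assms(3) by (simp add: field_simps)
    then show "real M - real i \<le> 2 * real M / real q * (real q - real i)" by simp
  qed simp
  moreover have "real (b choose (s - y)) \<le> r ^ (s - y) * real ((k - q) choose (s - y))"
  proof (rule binomial_le_power_mult)
    fix i
    have "r * i \<le> 1 * real i" using assms by (intro mult_right_mono) auto
    then show "real b - real i \<le> r * (real (k - q) - real i)"
      using assms by (simp add: of_nat_diff algebra_simps)
  qed (use assms in simp)
  ultimately have "real (M choose y) * real (b choose (s - y))
    \<le> ((2 * real M / real q) ^ y * real (q choose y)) * (r ^ (s - y) * real ((k - q) choose (s - y)))"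
    by (intro mult_mono) auto
  also have "\<dots> = (2 * real M / real q) ^ y * r ^ (s - y) * real ((q choose y) * ((k - q) choose (s - y)))"
    by simp
  also have "\<dots> \<le> (2 * real M / real q) ^ y * r ^ (s - y) * real (k choose s)"
  proof -
    have "(q choose y) * ((k - q) choose (s - y)) \<le> (\<Sum>j\<le>s. (q choose j) * ((k - q) choose (s - j)))"
      using assms(1) by (intro member_le_sum[of y _ "\<lambda>j. (q choose j) * ((k - q) choose (s - j))"]) auto
    also have "\<dots> = k choose s" using vandermonde[of q "k - q" s] assms(4) by simp
    finally show ?thesis using assms(5) by (intro mult_left_mono of_nat_mono) auto
  qed
  finally show ?thesis .
qed

section \<open>Counting sets by their encodings\<close>

lemma card_small_subsets:
  assumes "finite E" "z \<notin> E"
  shows "finite {T. T \<subseteq> E \<and> card T \<le> \<tau>}" "card {T. T \<subseteq> E \<and> card T \<le> \<tau>} \<le> (card E + 1) ^ \<tau>"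
proof -
  \<comment> \<open>Smaller subsets become lists of length exactly \<open>\<tau>\<close> by padding
    with the extra symbol \<open>z\<close>.\<close>
  let ?L = "{xs. set xs \<subseteq> insert z E \<and> length xs = \<tau>}"
  show "finite {T. T \<subseteq> E \<and> card T \<le> \<tau>}"
    by (rule finite_subset[of _ "Pow E"]) (use assms in auto)
  have "{T. T \<subseteq> E \<and> card T \<le> \<tau>} \<subseteq> (\<lambda>xs. set xs \<inter> E) ` ?L"
  proof clarify
    fix T assume T: "T \<subseteq> E" "card T \<le> \<tau>"
    have "finite T" using T assms finite_subset by blast
    then obtain xs where xs: "set xs = T" "distinct xs" using finite_distinct_list by blast
    then have "length xs = card T" using distinct_card by fastforce
    then show "T \<in> (\<lambda>xs. set xs \<inter> E) ` ?L"
      using T xs assms(2) by (intro image_eqI[of _ _ "xs @ replicate (\<tau> - card T) z"]) auto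
  qed
  moreover have "finite ?L" using assms by (simp add: finite_lists_length_eq)
  ultimately have "card {T. T \<subseteq> E \<and> card T \<le> \<tau>} \<le> card ?L" by (meson surj_card_le)
  also have "\<dots> = (card E + 1) ^ \<tau>" using assms by (simp add: card_lists_length_eq)
  finally show "card {T. T \<subseteq> E \<and> card T \<le> \<tau>} \<le> (card E + 1) ^ \<tau>" .
qed

lemma card_UN_le_mult:
  assumes "finite I" "\<And>i. i \<in> I \<Longrightarrow> card (f i) \<le> b"
  shows "card (\<Union>i\<in>I. f i) \<le> card I * b"
proof -
  have "card (\<Union>i\<in>I. f i) \<le> (\<Sum>i\<in>I. card (f i))" using assms(1) by (rule card_UN_le)
  also have "\<dots> \<le> card I * b" using sum_bounded_above[of I "\<lambda>i. card (f i)" b] assms(2) by simp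
  finally show ?thesis .
qed

text \<open>The triple (T, S, V) costs the power of \<open>n + 1\<close>. For
  \<open>y = card Y\<close>, the three factors of the summand count the choices of \<open>F\<close>
  inside \<open>Y\<close>, of \<open>Y\<close> inside \<open>popular T S\<close>, and of
  \<open>A - Y\<close> inside the container.\<close>

lemma card_encoded_le:
  fixes \<A> :: "int set set"
  assumes "\<And>A. A \<in> \<A> \<Longrightarrow> card A = s \<and> A \<subseteq> {1..int n}"
    and "\<And>A. A \<in> \<A> \<Longrightarrow> \<exists>T S V Y F. T \<subseteq> A \<and> S \<subseteq> A \<and> V \<subseteq> A \<and> T \<noteq> {} \<and>
       card T \<le> \<tau> \<and> card S \<le> \<tau> \<and> card V \<le> \<tau> \<and> card (popular T S) \<le> M \<and>
       A \<subseteq> popular T S \<and> F \<subseteq> Y \<and> Y \<subseteq> A \<and> card Y \<le> g \<and>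
       A - Y \<subseteq> container (popular T S) (F + F) V e \<and> card (container (popular T S) (F + F) V e) \<le> b"
  shows "card \<A> \<le> (n + 1) ^ (3 * \<tau>) * (\<Sum>y\<le>g. 2 ^ y * ((M choose y) * (b choose (s - y))))"
proof -
  define \<P> where "\<P> = {T. T \<subseteq> {1..int n} \<and> card T \<le> \<tau>}"
  define Q where "Q = {(T, S, V) \<in> \<P> \<times> \<P> \<times> \<P>. T \<noteq> {} \<and> card (popular T S) \<le> M}"
  define C where "C q F = (case q of (T, S, V) \<Rightarrow> container (popular T S) (F + F) V e)" for q F
  define X where "X q = (case q of (T, S, V) \<Rightarrow> popular T S)" for q :: "int set \<times> int set \<times> int set"
  define \<Y> where "\<Y> q y = {Y. Y \<subseteq> X q \<and> card Y = y}" for q y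
  define \<F> where "\<F> q Y = {F \<in> Pow Y. card (C q F) \<le> b}" for q Y
  define E where "E q y Y F = (\<lambda>Z. Y \<union> Z) ` {Z. Z \<subseteq> C q F \<and> card Z = s - y}" for q y Y F
  define U where "U q = (\<Union>y\<le>g. \<Union>Y\<in>\<Y> q y. \<Union>F\<in>\<F> q Y. E q y Y F)" for q
  have \<P>: "finite \<P>" "card \<P> \<le> (n + 1) ^ \<tau>"
    using card_small_subsets[of "{1..int n}" 0 \<tau>] unfolding \<P>_def by auto
  have Q: "finite Q" "card Q \<le> (n + 1) ^ (3 * \<tau>)"
  proof -
    have sub: "Q \<subseteq> \<P> \<times> \<P> \<times> \<P>" by (auto simp: Q_def)
    then show "finite Q" by (rule finite_subset) (use \<P> in auto)
    have "card Q \<le> card (\<P> \<times> \<P> \<times> \<P>)" using sub \<P> by (intro card_mono) auto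
    also have "\<dots> = card \<P> * (card \<P> * card \<P>)" by (simp add: card_cartesian_product)
    also have "\<dots> \<le> (n + 1) ^ \<tau> * ((n + 1) ^ \<tau> * (n + 1) ^ \<tau>)" using \<P>(2) by (intro mult_mono) auto
    also have "\<dots> = (n + 1) ^ (\<tau> + (\<tau> + \<tau>))" by (simp only: power_add)
    also have "\<tau> + (\<tau> + \<tau>) = 3 * \<tau>" by simp
    finally show "card Q \<le> (n + 1) ^ (3 * \<tau>)" .
  qed
  have X: "finite (X q)" "card (X q) \<le> M" if "q \<in> Q" for q
  proof -
    obtain T S V where q: "q = (T, S, V)" by (cases q) auto
    have "finite T" "finite S" "T \<noteq> {}" "card (popular T S) \<le> M"
      using that finite_subset[of _ "{1..int n}"] by (auto simp: Q_def \<P>_def q)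
    then show "finite (X q)" "card (X q) \<le> M" using popular_bounds(1) by (auto simp: X_def q)
  qed
  have C_sub: "C q F \<subseteq> X q" for q F
    by (auto simp: C_def X_def container_def common_nbrs_def split: prod.splits)
  have \<Y>: "finite (\<Y> q y)" "card (\<Y> q y) \<le> M choose y" "\<And>Y. Y \<in> \<Y> q y \<Longrightarrow> finite Y"
    if "q \<in> Q" for q y
  proof -
    show "finite (\<Y> q y)" by (rule finite_subset[of _ "Pow (X q)"]) (auto simp: \<Y>_def X(1)[OF that])
    show "card (\<Y> q y) \<le> M choose y"
      unfolding \<Y>_def n_subsets[OF X(1)[OF that]] using X(2)[OF that] by (rule binomial_right_mono)
    show "finite Y" if "Y \<in> \<Y> q y" for Y
      using that X(1)[OF \<open>q \<in> Q\<close>] finite_subset by (auto simp: \<Y>_def)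
  qed
  have E: "finite (E q y Y F)" "card (E q y Y F) \<le> b choose (s - y)"
    if "q \<in> Q" "F \<in> \<F> q Y" for q y Y F
  proof -
    have finC: "finite (C q F)" using C_sub X(1)[OF that(1)] by (rule finite_subset)
    have fin: "finite {Z. Z \<subseteq> C q F \<and> card Z = s - y}"
      by (rule finite_subset[of _ "Pow (C q F)"]) (use finC in auto)
    then show "finite (E q y Y F)" by (simp add: E_def)
    have "card (E q y Y F) \<le> card {Z. Z \<subseteq> C q F \<and> card Z = s - y}"
      unfolding E_def using fin by (rule card_image_le)
    also have "\<dots> = card (C q F) choose (s - y)" by (rule n_subsets[OF finC])
    also have "\<dots> \<le> b choose (s - y)" using that(2) by (intro binomial_right_mono) (auto simp: \<F>_def)
    finally show "card (E q y Y F) \<le> b choose (s - y)" .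
  qed
  have \<F>: "finite (\<F> q Y)" "card (\<F> q Y) \<le> 2 ^ y" if "q \<in> Q" "Y \<in> \<Y> q y" for q y Y
  proof -
    have Y: "finite Y" "card Y = y" using \<Y>(3)[OF that] that by (auto simp: \<Y>_def)
    then show "finite (\<F> q Y)" by (simp add: \<F>_def)
    have "card (\<F> q Y) \<le> card (Pow Y)" using Y by (intro card_mono) (auto simp: \<F>_def)
    then show "card (\<F> q Y) \<le> 2 ^ y" using Y by (simp add: card_Pow)
  qed
  have U: "finite (U q)" "card (U q) \<le> (\<Sum>y\<le>g. 2 ^ y * ((M choose y) * (b choose (s - y))))"
    if q: "q \<in> Q" for q
  proof -
    show "finite (U q)" unfolding U_def using q \<Y>(1) \<F>(1) E(1) by (intro finite_UN_I) auto
    have "card (U q) \<le> (\<Sum>y\<le>g. card (\<Union>Y\<in>\<Y> q y. \<Union>F\<in>\<F> q Y. E q y Y F))"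
      unfolding U_def by (rule card_UN_le) simp
    also have "\<dots> \<le> (\<Sum>y\<le>g. (M choose y) * (2 ^ y * (b choose (s - y))))"
    proof (rule sum_mono)
      fix y
      have "card (\<Union>F\<in>\<F> q Y. E q y Y F) \<le> 2 ^ y * (b choose (s - y))" if Y: "Y \<in> \<Y> q y" for Y
      proof -
        have "card (\<Union>F\<in>\<F> q Y. E q y Y F) \<le> card (\<F> q Y) * (b choose (s - y))"
          using \<F>(1)[OF q Y] E(2)[OF q] by (rule card_UN_le_mult)
        also have "\<dots> \<le> 2 ^ y * (b choose (s - y))" using \<F>(2)[OF q Y] by (rule mult_right_mono) simp
        finally show ?thesis .
      qed
      then have "card (\<Union>Y\<in>\<Y> q y. \<Union>F\<in>\<F> q Y. E q y Y F) \<le> card (\<Y> q y) * (2 ^ y * (b choose (s - y)))"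
        using \<Y>(1)[OF q] by (intro card_UN_le_mult)
      also have "\<dots> \<le> (M choose y) * (2 ^ y * (b choose (s - y)))"
        using \<Y>(2)[OF q] by (rule mult_right_mono) simp
      finally show "card (\<Union>Y\<in>\<Y> q y. \<Union>F\<in>\<F> q Y. E q y Y F) \<le> (M choose y) * (2 ^ y * (b choose (s - y)))" .
    qed
    finally show "card (U q) \<le> (\<Sum>y\<le>g. 2 ^ y * ((M choose y) * (b choose (s - y))))"
      by (simp add: mult_ac)
  qed
  have "\<A> \<subseteq> (\<Union>q\<in>Q. U q)"
  proof
    fix A assume A: "A \<in> \<A>"
    obtain T S V Y F where *: "T \<subseteq> A" "S \<subseteq> A" "V \<subseteq> A" "T \<noteq> {}" "card T \<le> \<tau>" "card S \<le> \<tau>" "card V \<le> \<tau>"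
      "card (popular T S) \<le> M" "A \<subseteq> popular T S" "F \<subseteq> Y" "Y \<subseteq> A" "card Y \<le> g"
      "A - Y \<subseteq> container (popular T S) (F + F) V e" "card (container (popular T S) (F + F) V e) \<le> b"
      using assms(2)[OF A] by metis
    have A': "card A = s" "A \<subseteq> {1..int n}" using assms(1)[OF A] by auto
    let ?q = "(T, S, V)"
    have "finite Y" using * A' by (meson finite_atLeastAtMost_int finite_subset)
    have "?q \<in> Q" using * A' by (auto simp: Q_def \<P>_def)
    moreover have "Y \<in> \<Y> ?q (card Y)" using * by (auto simp: \<Y>_def X_def)
    moreover have "F \<in> \<F> ?q Y" using * by (auto simp: \<F>_def C_def)
    moreover have "A \<in> E ?q (card Y) Y F"
      unfolding E_def
    proof (rule image_eqI[of _ _ "A - Y"])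
      show "A = Y \<union> (A - Y)" using *(11) by auto
      have "card (A - Y) = s - card Y" using *(11) A' \<open>finite Y\<close> by (simp add: card_Diff_subset)
      then show "A - Y \<in> {Z. Z \<subseteq> C ?q F \<and> card Z = s - card Y}" using *(13) by (simp add: C_def)
    qed
    ultimately show "A \<in> (\<Union>q\<in>Q. U q)" using *(12) unfolding U_def by blast
  qed
  then have "card \<A> \<le> card (\<Union>q\<in>Q. U q)" using Q(1) U(1) by (intro card_mono) auto
  also have "\<dots> \<le> card Q * (\<Sum>y\<le>g. 2 ^ y * ((M choose y) * (b choose (s - y))))"
    using Q(1) U(2) by (rule card_UN_le_mult)
  also have "\<dots> \<le> (n + 1) ^ (3 * \<tau>) * (\<Sum>y\<le>g. 2 ^ y * ((M choose y) * (b choose (s - y))))"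
    using Q(2) by (rule mult_right_mono) simp
  finally show ?thesis .
qed

section \<open>Comparison with the subsets of an interval\<close>

definition near_progression :: "real \<Rightarrow> nat \<Rightarrow> nat \<Rightarrow> int set set" where
  "near_progression \<eta> s m = {A. \<exists>P. arith_prog P \<and> real (card P) \<le> real m / 2 + \<eta> * real m \<and>
     real (card (A - P)) \<le> \<eta> * real s}"

lemma finite_small_doubling: "finite (small_doubling n s m)"
  by (rule finite_subset[of _ "Pow {1..int n}"]) (auto simp: small_doubling_def)

text \<open>The sums of a subset of \<open>{1..k}\<close> are among the \<open>2 * k - 1\<close>
  integers from 2 to \<open>2 * k\<close>.\<close>

lemma card_small_doubling_ge:
  assumes "k \<le> n" "2 * k \<le> m + 1"
  shows "k choose s \<le> card (small_doubling n s m)"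
proof -
  have "{A. A \<subseteq> {1..int k} \<and> card A = s} \<subseteq> small_doubling n s m"
  proof clarify
    fix A :: "int set" assume A: "A \<subseteq> {1..int k}" "s = card A"
    have "A + A \<subseteq> {2..2 * int k}"
    proof
      fix z assume "z \<in> A + A"
      then obtain x y where "x \<in> A" "y \<in> A" "z = x + y" by (rule set_plus_elim)
      with A(1) have "1 \<le> x" "x \<le> int k" "1 \<le> y" "y \<le> int k" "z = x + y" by auto
      then show "z \<in> {2..2 * int k}" by simp
    qed
    then have "card (A + A) \<le> card {2..2 * int k}" by (intro card_mono) auto
    also have "\<dots> \<le> m" using assms(2) by simp
    finally show "A \<in> small_doubling n (card A) m"
      using A assms(1) by (auto simp: small_doubling_def)
  qed
  then have "card {A. A \<subseteq> {1..int k} \<and> card A = s} \<le> card (small_doubling n s m)"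
    using finite_small_doubling by (rule card_mono[rotated])
  then show ?thesis by (simp add: n_subsets)
qed

text \<open>Settles the case where an interval of length about \<open>m / 2\<close> does not fit
  into \<open>{1..n}\<close>: the whole of \<open>{1..n}\<close> serves as the progression.\<close>

lemma interval_near_progression:
  assumes "1 \<le> n" "2 * n \<le> m" "0 \<le> \<eta>" "A \<subseteq> {1..int n}"
  shows "A \<in> near_progression \<eta> s m"
proof -
  have "{1..int n} = {1 + int i * 1 | i. i < n}"
  proof (intro equalityI subsetI)
    fix x assume "x \<in> {1..int n}"
    then have "x = 1 + int (nat (x - 1)) * 1" "nat (x - 1) < n" by auto
    then show "x \<in> {1 + int i * 1 | i. i < n}" by blast
  qed auto
  then have "arith_prog {1..int n}"
    unfolding arith_prog_def using assms(1) by (intro exI[of _ 1] exI[of _ n]) auto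
  moreover have "A - {1..int n} = {}" using assms(4) by auto
  then have "card (A - {1..int n}) = 0" by (metis card.empty)
  moreover have "real (card {1..int n}) \<le> real m / 2 + \<eta> * real m"
  proof -
    have "0 \<le> \<eta> * real m" using assms(3) by simp
    then show ?thesis using assms(2) by simp
  qed
  ultimately show ?thesis unfolding near_progression_def using assms(3)
    by (auto intro!: exI[of _ "{1..int n}"])
qed

text \<open>\<open>binomial_product_le\<close> with ratio \<open>1 - \<kappa>\<close> and
  \<open>q\<close> about \<open>\<kappa> * k\<close>. The smaller container gains exp (- \<kappa>
  s), while the few freely specified elements cost at most exp (\<kappa> s / 4).\<close>

lemma binomial_weight_le:
  fixes \<kappa> \<gamma> :: real and b k m s y :: nat
  assumes \<kappa>: "0 < \<kappa>" "\<kappa> \<le> 1 / 9" and \<gamma>: "\<gamma> \<le> \<kappa> / 8" "\<gamma> * ln (32 / \<kappa>) \<le> \<kappa> / 4"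
    and \<kappa>k: "1 \<le> \<kappa> * k" and ks: "s \<le> 2 * k" and km: "m \<le> 2 * k"
    and b: "b \<le> (1 - 3 * \<kappa>) * k" and y: "y \<le> \<gamma> * s"
  shows "2 ^ y * (real ((2 * m) choose y) * real (b choose (s - y)))
    \<le> exp (- (3 * \<kappa> / 4 * s)) * real (k choose s)"
proof -
  define q where "q = nat \<lceil>\<kappa> * k\<rceil>"
  have ln_pos: "0 < ln (32 / \<kappa>)" using \<kappa> by (simp add: field_simps)
  have "\<gamma> * s \<le> 1 * real s" using \<gamma> \<kappa> by (intro mult_right_mono) auto
  then have ys: "y \<le> s" using y by simp
  have q: "\<kappa> * k \<le> q" "q \<le> 2 * (\<kappa> * k)" using \<kappa>k unfolding q_def by linarith+
  have "0 < q" using q \<kappa>k by linarith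
  have "\<kappa> * k \<le> 1 / 9 * k" using \<kappa> by (intro mult_right_mono) auto
  then have "q \<le> k" using q by linarith
  have "2 * y \<le> q"
  proof -
    have "\<gamma> * s \<le> \<kappa> / 8 * (2 * k)" using \<gamma> \<kappa> ks by (intro mult_mono) auto
    then show ?thesis using y q \<kappa>k by simp
  qed
  have "b \<le> (1 - \<kappa>) * (real k - real q)"
  proof -
    \<comment> \<open>The 3 comes from (1 - \<kappa>) (1 - 2 \<kappa>) \<ge> 1 - 3 \<kappa>, where 2
      \<kappa> allows for rounding \<open>q\<close> up.\<close>
    have "(1 - 3 * \<kappa>) * k \<le> (1 - \<kappa>) * (real k - 2 * (\<kappa> * k))" using \<kappa> by (simp add: algebra_simps)
    also have "\<dots> \<le> (1 - \<kappa>) * (real k - real q)" using \<kappa> q by (intro mult_left_mono) auto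
    finally show ?thesis using b by simp
  qed
  then have "real ((2 * m) choose y) * real (b choose (s - y))
    \<le> (2 * real (2 * m) / q) ^ y * (1 - \<kappa>) ^ (s - y) * real (k choose s)"
    using \<open>2 * y \<le> q\<close> \<open>0 < q\<close> \<open>q \<le> k\<close> ys \<kappa> by (intro binomial_product_le) auto
  then have "2 ^ y * (real ((2 * m) choose y) * real (b choose (s - y)))
    \<le> 2 ^ y * ((2 * real (2 * m) / q) ^ y * (1 - \<kappa>) ^ (s - y) * real (k choose s))"
    by (intro mult_left_mono) auto
  also have "\<dots> = (8 * real m / real q) ^ y * (1 - \<kappa>) ^ (s - y) * real (k choose s)"
    by (simp flip: power_mult_distrib)
  \<comment> \<open>The constant is doubled from 16 to 32 to make room for
    \<open>(1 - \<kappa>) ^ y\<close>, which completes the other power to exponent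
    \<open>s\<close>.\<close>
  also have "\<dots> \<le> ((32 / \<kappa>) * (1 - \<kappa>)) ^ y * (1 - \<kappa>) ^ (s - y) * real (k choose s)"
  proof (intro mult_right_mono power_mono)
    have "8 * real m / real q \<le> 8 * (2 * real k) / (\<kappa> * real k)"
      using km q \<kappa>k by (intro frac_le) auto
    also have "\<dots> = 16 / \<kappa>" using \<kappa>k by auto
    also have "\<dots> \<le> 32 / \<kappa> * (1 - \<kappa>)" using \<kappa> by (simp add: field_simps)
    finally show "8 * real m / real q \<le> 32 / \<kappa> * (1 - \<kappa>)" by simp
  qed (use \<kappa> in auto)
  also have "\<dots> = (32 / \<kappa>) ^ y * ((1 - \<kappa>) ^ y * (1 - \<kappa>) ^ (s - y)) * real (k choose s)"
    by (simp only: power_mult_distrib mult.assoc)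
  also have "(1 - \<kappa>) ^ y * (1 - \<kappa>) ^ (s - y) = (1 - \<kappa>) ^ s"
    using ys by (simp flip: power_add)
  also have "(32 / \<kappa>) ^ y * (1 - \<kappa>) ^ s * real (k choose s)
    \<le> exp (\<kappa> / 4 * s) * exp (- (\<kappa> * s)) * real (k choose s)"
  proof (intro mult_right_mono mult_mono)
    have "(32 / \<kappa>) ^ y = exp (y * ln (32 / \<kappa>))" using \<kappa> by (simp add: exp_of_nat_mult)
    also have "\<dots> \<le> exp (\<gamma> * s * ln (32 / \<kappa>))" using y ln_pos by (intro iffD2[OF exp_le_cancel_iff] mult_right_mono) auto
    also have "\<dots> \<le> exp (\<kappa> / 4 * s)"
    proof -
      have "\<gamma> * ln (32 / \<kappa>) * s \<le> \<kappa> / 4 * s" using \<gamma>(2) by (intro mult_right_mono) auto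
      then show ?thesis by (simp add: mult_ac)
    qed
    finally show "(32 / \<kappa>) ^ y \<le> exp (\<kappa> / 4 * s)" .
    have "(1 - \<kappa>) ^ s \<le> exp (- \<kappa>) ^ s"
      using \<kappa> exp_ge_add_one_self[of "- \<kappa>"] by (intro power_mono) auto
    also have "\<dots> = exp (- (\<kappa> * s))" by (simp add: exp_of_nat_mult[symmetric] mult.commute)
    finally show "(1 - \<kappa>) ^ s \<le> exp (- (\<kappa> * s))" .
  qed (use \<kappa> in auto)
  also have "\<dots> = exp (- (3 * \<kappa> / 4 * s)) * real (k choose s)" by (simp flip: exp_add)
  finally show ?thesis .
qed

lemma power_le_exp_log:
  fixes n \<tau> :: nat
  assumes n: "2 \<le> n"
  shows "(real n + 1) ^ (3 * \<tau>) \<le> exp (6 * (\<tau> * log 2 n))"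
proof -
  have "2 * real n \<le> real n * real n" using n by (intro mult_right_mono) auto
  then have "real n + 1 \<le> real n * real n" using n by linarith
  then have "ln (real n + 1) \<le> ln (real n * real n)" using n by simp
  also have "\<dots> = 2 * ln (real n)" using n by (simp add: ln_mult)
  also have "ln (real n) = log 2 n * ln 2" using n by (simp add: log_def)
  also have "\<dots> \<le> log 2 n * 1" using n ln_2_less_1 by (intro mult_left_mono) auto
  finally have ln_n: "ln (real n + 1) \<le> 2 * log 2 n" by simp
  have "(real n + 1) ^ (3 * \<tau>) = exp (real (3 * \<tau>) * ln (real n + 1))"
    by (subst exp_of_nat_mult) simp
  also have "\<dots> \<le> exp (real (3 * \<tau>) * (2 * log 2 n))"
    using ln_n by (subst exp_le_cancel_iff, intro mult_left_mono) auto
  finally show ?thesis by (simp add: mult_ac)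
qed

text \<open>Here \<open>x\<close>, \<open>L\<close>, \<open>S\<close> stand for \<open>m\<close>,
  \<open>log 2 n\<close>, \<open>s\<close>. The hypothesis on \<open>m\<close> becomes a bound for
  \<open>sqrt x * L\<close> by \<open>sqrt c * S\<close>, which pays for the sets of size O(sqrt m);
  the boundedly many further elements are paid for by \<open>L \<le> c * S\<close>.\<close>

lemma fingerprint_cost_le:
  fixes \<kappa> c L x S \<tau> :: real
  assumes \<kappa>: "0 < \<kappa>" "\<kappa> \<le> 1 / 9" and c: "0 \<le> c" "c \<le> (\<kappa> / 200)\<^sup>2" and L: "1 \<le> L" "L \<le> c * S"
    and x: "0 \<le> x" "x * L\<^sup>2 \<le> c * S\<^sup>2" and "0 \<le> S" and \<tau>: "\<tau> \<le> 2 * (sqrt x + 1) + (4 / \<kappa> + 1)"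
  shows "6 * (\<tau> * L) \<le> \<kappa> / 8 * S"
proof -
  have "\<tau> * L \<le> (2 * (sqrt x + 1) + (4 / \<kappa> + 1)) * L" using \<tau> L by (intro mult_right_mono) auto
  also have "\<dots> = 2 * (sqrt x * L) + (3 + 4 / \<kappa>) * L" by (simp add: algebra_simps)
  also have "\<dots> \<le> 2 * (\<kappa> / 200 * S) + 5 / 40000 * (\<kappa> * S)"
  proof (intro add_mono mult_left_mono)
    have "sqrt (x * L\<^sup>2) \<le> sqrt (c * S\<^sup>2)" using x(2) by (rule real_sqrt_le_mono)
    then have "sqrt x * L \<le> sqrt c * S" using L \<open>0 \<le> S\<close> by (simp add: real_sqrt_mult)
    also have "\<dots> \<le> \<kappa> / 200 * S"
    proof -
      have "sqrt c \<le> sqrt ((\<kappa> / 200)\<^sup>2)" using c(2) by (rule real_sqrt_le_mono)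
      then show ?thesis using \<kappa> \<open>0 \<le> S\<close> by (intro mult_right_mono) auto
    qed
    finally show "sqrt x * L \<le> \<kappa> / 200 * S" .
    have "(3 + 4 / \<kappa>) * L \<le> (3 + 4 / \<kappa>) * (c * S)" using \<kappa> L by (intro mult_left_mono) auto
    also have "\<dots> \<le> (3 + 4 / \<kappa>) * ((\<kappa> / 200)\<^sup>2 * S)"
      using \<kappa> c(2) \<open>0 \<le> S\<close> by (intro mult_left_mono mult_right_mono) auto
    also have "\<dots> = (3 * \<kappa> + 4) / 40000 * (\<kappa> * S)"
      using \<kappa> by (simp add: field_simps power2_eq_square)
    also have "\<dots> \<le> 5 / 40000 * (\<kappa> * S)" using \<kappa> \<open>0 \<le> S\<close> by (intro mult_right_mono) auto
    finally show "(3 + 4 / \<kappa>) * L \<le> 5 / 40000 * (\<kappa> * S)" .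
  qed simp
  also have "\<dots> \<le> \<kappa> / 48 * S" using \<kappa> \<open>0 \<le> S\<close> by simp
  finally show ?thesis by linarith
qed

text \<open>A set far from every progression has an inner container of size at most
  \<open>b\<close>, as a larger one would itself lie in a short progression.
  \<open>card_encoded_le\<close> shows that there are few such sets compared with the
  \<open>k choose s\<close> subsets of an interval.\<close>

lemma few_far_from_progression:
  fixes \<eta> :: real
  assumes \<eta>: "0 < \<eta>"
  obtains c where "0 < c"
    "\<And>n s m. \<lbrakk>2 \<le> n; 0 < s; small_doubling n s m \<noteq> {}; real m * (log 2 (real n))\<^sup>2 \<le> c * (real s)\<^sup>2\<rbrakk>
      \<Longrightarrow> real (card (small_doubling n s m - near_progression \<eta> s m)) \<le> \<eta> * real (card (small_doubling n s m))"
proof -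
  obtain \<kappa> m0 :: real where \<kappa>: "0 < \<kappa>" "\<kappa> \<le> 1 / 9" and progression:
    "\<And>B D :: int set. \<And>m :: nat. \<lbrakk>m0 \<le> real m; finite B; finite D; card D \<le> m;
       \<And>x. x \<in> B \<Longrightarrow> real (card {y \<in> B. x + y \<notin> D}) \<le> \<kappa> * real m;
       (1 - 3 * \<kappa>) * real m / 2 \<le> real (card B)\<rbrakk>
     \<Longrightarrow> \<exists>P. arith_prog P \<and> B \<subseteq> P \<and> real (card P) \<le> real m / 2 + \<eta> * real m"
    by (rule subset_arith_prog_of_almost_closed[OF \<eta>]) (rule that; blast)
  define \<gamma> where "\<gamma> = Min {\<eta>, \<kappa> / 8, \<kappa> / (4 * ln (32 / \<kappa>))}"
  have ln_pos: "0 < ln (32 / \<kappa>)" using \<kappa> by (simp add: field_simps)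
  have \<gamma>_pos: "0 < \<gamma>" using \<eta> \<kappa> ln_pos unfolding \<gamma>_def by (subst Min_gr_iff) auto
  have \<gamma>: "\<gamma> \<le> \<eta>" "\<gamma> \<le> \<kappa> / 8" "\<gamma> \<le> \<kappa> / (4 * ln (32 / \<kappa>))"
    unfolding \<gamma>_def by (rule Min_le; simp)+
  obtain c1 where c1: "0 < c1" and fingerprint:
    "\<And>A m t0. \<lbrakk>finite A; A \<noteq> {}; card (A + A) \<le> m; real m \<le> c1 * (real (card A))\<^sup>2; 1 \<le> c1 * real (card A);
       0 < t0; t0 \<le> card A; m \<le> t0 * t0\<rbrakk> \<Longrightarrow>
     has_fingerprint \<gamma> \<kappa> m t0 A"
    by (rule exists_fingerprint[OF \<gamma>_pos \<kappa>(1)]) (rule that; blast)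
  define c where "c = Min {c1, 1, \<kappa>\<^sup>2 / 128, \<kappa> * \<eta> / 2, 1 / max m0 1, (\<kappa> / 200)\<^sup>2, \<kappa> / 2}"
  have c_pos: "0 < c" using \<eta> \<kappa> c1 unfolding c_def by (subst Min_gr_iff) auto
  have c: "c \<le> c1" "c \<le> 1" "c \<le> \<kappa>\<^sup>2 / 128" "c \<le> \<kappa> * \<eta> / 2" "c \<le> 1 / max m0 1"
    "c \<le> (\<kappa> / 200)\<^sup>2" "c \<le> \<kappa> / 2"
    unfolding c_def by (rule Min_le; simp)+
  have main: "real (card (small_doubling n s m - near_progression \<eta> s m)) \<le> \<eta> * real (card (small_doubling n s m))"
    if n: "2 \<le> n" and s: "0 < s" and ne: "small_doubling n s m \<noteq> {}"
      and m_le: "real m * (log 2 (real n))\<^sup>2 \<le> c * (real s)\<^sup>2" for n s m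
  proof -
    define L where "L = log 2 (real n)"
    \<comment> \<open>The largest length of an interval having at most \<open>m\<close>
      sums.\<close>
    define k where "k = (m + 1) div 2"
    have L: "1 \<le> L" using n unfolding L_def by simp
    then have "1 \<le> L\<^sup>2" "L \<le> L\<^sup>2" by (auto simp: power2_eq_square mult_le_cancel_right1 intro: mult_mono[of 1 L 1 L, simplified])
    have sm: "s \<le> m"
    proof -
      obtain A where A: "A \<in> small_doubling n s m" using ne by auto
      then have "finite A" using finite_subset by (auto simp: small_doubling_def)
      with card_le_card_sumset[of A] A show ?thesis by (auto simp: small_doubling_def)
    qed
    \<comment> \<open>As \<open>s \<le> m\<close>, the bound on \<open>m\<close> also forces
      \<open>L\<^sup>2 \<le> c * s\<close>, so \<open>s\<close> is large enough to absorb all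
      constants and rounding.\<close>
    have "s * L\<^sup>2 \<le> m * L\<^sup>2" using sm by (intro mult_right_mono) auto
    with m_le have "s * L\<^sup>2 \<le> s * (c * s)" unfolding L_def by (simp add: power2_eq_square mult_ac)
    then have L2: "L\<^sup>2 \<le> c * s" using s by simp
    then have cs: "1 \<le> c * s" using \<open>1 \<le> L\<^sup>2\<close> by linarith
    have scale: "1 \<le> d * s" if "c \<le> d" for d
    proof -
      have "c * s \<le> d * s" using that by (intro mult_right_mono) auto
      with cs show ?thesis by simp
    qed
    have "real m * 1 \<le> real m * L\<^sup>2" using \<open>1 \<le> L\<^sup>2\<close> by (intro mult_left_mono) auto
    then have mc: "m \<le> c * (real s)\<^sup>2" using m_le unfolding L_def by simp
    have k: "m \<le> 2 * k" "2 * k \<le> m + 1" by (auto simp: k_def)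
    show ?thesis
    proof (cases "k \<le> n")
      case False
      then have "2 * n \<le> m" using k by auto
      then have "small_doubling n s m - near_progression \<eta> s m = {}"
        using interval_near_progression[of n m \<eta> _ s] n \<eta> by (auto simp: small_doubling_def)
      then have "card (small_doubling n s m - near_progression \<eta> s m) = 0" by (metis card.empty)
      then show ?thesis using \<eta> by simp
    next
      case True
      define t0 where "t0 = nat \<lceil>sqrt m\<rceil>"
      define \<tau> where "\<tau> = 2 * t0 + nat \<lceil>4 / \<kappa>\<rceil>"
      define e where "e = nat \<lfloor>\<kappa> * real m\<rfloor>"
      define g where "g = nat \<lfloor>\<gamma> * s\<rfloor>"
      define b where "b = nat \<lfloor>(1 - 3 * \<kappa>) * k\<rfloor>"
      define W where "W = exp (- (3 * \<kappa> / 4 * s)) * (k choose s)"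
      have t0: "sqrt m \<le> t0" "t0 \<le> sqrt m + 1" unfolding t0_def by (auto simp: ceiling_correct)
      have sqrt_m: "sqrt m \<le> sqrt c * s"
        using real_sqrt_le_mono[OF mc] s by (simp add: real_sqrt_mult)
      also have "\<dots> \<le> 1 * real s" using c(2) by (intro mult_right_mono) auto
      finally have "t0 \<le> s" unfolding t0_def by (simp add: ceiling_le_iff)
      have "0 < t0" using s sm unfolding t0_def by simp
      have "m = sqrt m * sqrt m" by simp
      also have "\<dots> \<le> real t0 * real t0" using t0 by (intro mult_mono) auto
      finally have "real m \<le> real (t0 * t0)" by simp
      then have mt: "m \<le> t0 * t0" by (simp only: of_nat_le_iff)
      have ks: "real s \<le> 2 * k" using sm k by simp
      have "1 \<le> \<kappa> / 2 * s" using c(7) by (rule scale)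
      also have "\<dots> \<le> \<kappa> / 2 * (2 * k)" using \<kappa> ks by (intro mult_left_mono) auto
      finally have \<kappa>k: "1 \<le> \<kappa> * k" by simp
      have b: "b \<le> (1 - 3 * \<kappa>) * k" "\<And>x::nat. b < x \<Longrightarrow> (1 - 3 * \<kappa>) * k \<le> x"
        using \<kappa> unfolding b_def by (simp, linarith)
      have "card (small_doubling n s m - near_progression \<eta> s m)
        \<le> (n + 1) ^ (3 * \<tau>) * (\<Sum>y\<le>g. 2 ^ y * (((2 * m) choose y) * (b choose (s - y))))"
      proof (rule card_encoded_le)
        fix A assume "A \<in> small_doubling n s m - near_progression \<eta> s m"
        then have A: "card A = s" "A \<subseteq> {1..int n}" "card (A + A) \<le> m" and far: "A \<notin> near_progression \<eta> s m"
          by (auto simp: small_doubling_def)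
        then show "card A = s \<and> A \<subseteq> {1..int n}" by simp
        have fin: "finite A" "A \<noteq> {}" using A s finite_subset by auto
        have "c * (real s)\<^sup>2 \<le> c1 * (real s)\<^sup>2" using c(1) by (intro mult_right_mono) auto
        then have "real m \<le> c1 * (real s)\<^sup>2" using mc by linarith
        then have "has_fingerprint \<gamma> \<kappa> m t0 A"
          using fin A(1,3) scale[OF c(1)] \<open>0 < t0\<close> \<open>t0 \<le> s\<close> mt by (intro fingerprint) auto
        then obtain T S V Y F where *: "T \<subseteq> A" "S \<subseteq> A" "V \<subseteq> A" "F \<subseteq> Y" "Y \<subseteq> A" "card T = t0" "card S \<le> 2 * t0"
          "real (card V) \<le> 4 / \<kappa>" "real (card Y) \<le> \<gamma> * real s" "A \<subseteq> popular T S"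
          "A - Y \<subseteq> container (popular T S) (F + F) V e"
          unfolding e_def has_fingerprint_def A(1) by metis
        let ?B = "container (popular T S) (F + F) V e"
        have "T \<noteq> {}" using * \<open>0 < t0\<close> by auto
        have "F \<subseteq> A" using *(4,5) by simp
        have fin': "finite T" "finite S" "finite F" "finite Y"
          using *(1,2,5) \<open>F \<subseteq> A\<close> fin(1) by (auto intro: finite_subset)
        have sums: "card (S + T) \<le> m" "card (F + F) \<le> m"
          using card_sumset_mono[OF fin(1) *(2,1)] card_sumset_mono[OF fin(1) \<open>F \<subseteq> A\<close> \<open>F \<subseteq> A\<close>] A(3) by auto
        have X: "finite (popular T S)" "card (popular T S) \<le> 2 * m"
          using popular_bounds[OF fin'(1) \<open>T \<noteq> {}\<close> fin'(2)] sums by auto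
        have "?B \<subseteq> popular T S" by (auto simp: container_def common_nbrs_def)
        then have finB: "finite ?B" using X finite_subset by blast
        have "card ?B \<le> b"
        proof (rule ccontr)
          \<comment> \<open>With \<open>D = F + F\<close>, the structure result puts the container
            into a progression \<open>P\<close>; then \<open>A - P\<close> lies in \<open>Y\<close>,
            against the choice of \<open>A\<close>.\<close>
          assume "\<not> card ?B \<le> b"
          then have "(1 - 3 * \<kappa>) * k \<le> card ?B" by (intro b(2)) simp
          moreover have "(1 - 3 * \<kappa>) * (m / 2) \<le> (1 - 3 * \<kappa>) * k" using k \<kappa> by (intro mult_left_mono) auto
          ultimately have "(1 - 3 * \<kappa>) * m / 2 \<le> card ?B" by simp
          moreover have "card {y \<in> ?B. x + y \<notin> F + F} \<le> \<kappa> * m" if "x \<in> ?B" for x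
          proof -
            let ?N = "common_nbrs (popular T S) (F + F) V"
            have "card {y \<in> ?B. x + y \<notin> F + F} \<le> card {y \<in> ?N. x + y \<notin> F + F}"
              using X(1) by (intro card_mono) (auto simp: container_def common_nbrs_def)
            also have "\<dots> \<le> e" using that by (simp add: container_def)
            finally show ?thesis using \<kappa> unfolding e_def by (simp add: le_nat_iff le_floor_iff)
          qed
          moreover have "m0 \<le> m"
          proof -
            have "1 \<le> 1 / max m0 1 * s" using c(5) by (rule scale)
            then have "max m0 1 \<le> s" by (simp add: field_simps)
            then show ?thesis using sm by simp
          qed
          ultimately obtain P where P: "arith_prog P" "?B \<subseteq> P" "card P \<le> m / 2 + \<eta> * m"
            using progression[OF _ finB finite_set_plus[OF fin'(3,3)] sums(2)] by blast
          have "A - P \<subseteq> Y" using P(2) *(11) by auto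
          then have "real (card (A - P)) \<le> real (card Y)" using fin'(4) by (intro of_nat_mono card_mono)
          also have "\<dots> \<le> \<gamma> * s" by (rule *(9))
          also have "\<dots> \<le> \<eta> * s" using \<gamma>(1) by (intro mult_right_mono) auto
          finally show False using far P unfolding near_progression_def by auto
        qed
        moreover have "card V \<le> \<tau>" using *(8) unfolding \<tau>_def by linarith
        moreover have "card Y \<le> g" using *(9) unfolding g_def by (simp add: le_nat_iff le_floor_iff)
        ultimately show "\<exists>T S V Y F. T \<subseteq> A \<and> S \<subseteq> A \<and> V \<subseteq> A \<and> T \<noteq> {} \<and>
          card T \<le> \<tau> \<and> card S \<le> \<tau> \<and> card V \<le> \<tau> \<and> card (popular T S) \<le> 2 * m \<and>
          A \<subseteq> popular T S \<and> F \<subseteq> Y \<and> Y \<subseteq> A \<and> card Y \<le> g \<and>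
          A - Y \<subseteq> container (popular T S) (F + F) V e \<and> card (container (popular T S) (F + F) V e) \<le> b"
          using *(1-7,10,11) X(2) \<open>T \<noteq> {}\<close>
          by - (rule exI[of _ T], rule exI[of _ S], rule exI[of _ V], rule exI[of _ Y], rule exI[of _ F],
            simp add: \<tau>_def)
      qed
      then have "real (card (small_doubling n s m - near_progression \<eta> s m))
        \<le> real ((n + 1) ^ (3 * \<tau>) * (\<Sum>y\<le>g. 2 ^ y * (((2 * m) choose y) * (b choose (s - y)))))"
        by (simp only: of_nat_le_iff)
      also have "\<dots> = (real n + 1) ^ (3 * \<tau>) * (\<Sum>y\<le>g. 2 ^ y * (real ((2 * m) choose y) * real (b choose (s - y))))"
        by (simp add: add.commute)
      \<comment> \<open>In units of \<open>\<kappa> * s\<close> the exponents are 1/8 for the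
        triples, 1/8 for the number of summands and -3/4 from \<open>W\<close>, which leaves
        -1/2.\<close>
      also have "\<dots> \<le> exp (\<kappa> / 8 * s) * (exp (\<kappa> / 8 * s) * W)"
      proof (intro mult_mono)
        have "real (nat \<lceil>4 / \<kappa>\<rceil>) \<le> 4 / \<kappa> + 1" using \<kappa> by (simp add: of_nat_nat)
        then have "\<tau> \<le> 2 * (sqrt m + 1) + (4 / \<kappa> + 1)" using t0 unfolding \<tau>_def by simp
        then have "6 * (\<tau> * L) \<le> \<kappa> / 8 * s"
          using \<kappa> c_pos c(6) L L2 \<open>L \<le> L\<^sup>2\<close> m_le[folded L_def]
          by (intro fingerprint_cost_le[of \<kappa> c L "real s" "real m"]) auto
        then show "(real n + 1) ^ (3 * \<tau>) \<le> exp (\<kappa> / 8 * s)"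
          using power_le_exp_log[OF n, of \<tau>] unfolding L_def by (meson exp_le_cancel_iff order_trans)
      next
        have "\<gamma> \<le> 1" using \<gamma> \<kappa> by linarith
        have g: "g \<le> \<gamma> * s" using \<gamma>_pos unfolding g_def by simp
        have "\<gamma> * s \<le> 1 * real s" using \<open>\<gamma> \<le> 1\<close> by (intro mult_right_mono) auto
        with g have gs: "g \<le> s" by simp
        have summand: "2 ^ y * (real ((2 * m) choose y) * real (b choose (s - y))) \<le> W" if "y \<le> g" for y
          unfolding W_def
        proof (rule binomial_weight_le)
          show "\<gamma> * ln (32 / \<kappa>) \<le> \<kappa> / 4" using \<gamma>(3) ln_pos by (simp add: field_simps)
          show "y \<le> \<gamma> * s" using that g by linarith
          show "s \<le> 2 * k" using sm k by simp
        qed (use \<kappa> \<gamma> \<kappa>k k b in auto)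
        have "0 \<le> W" by (simp add: W_def)
        have "(\<Sum>y\<le>g. 2 ^ y * (real ((2 * m) choose y) * real (b choose (s - y)))) \<le> (\<Sum>y\<le>g. W)"
          by (intro sum_mono summand) simp
        also have "\<dots> = (real g + 1) * W" by simp
        also have "\<dots> \<le> exp (\<kappa> / 8 * s) * W"
        proof (intro mult_right_mono \<open>0 \<le> W\<close>)
          have "1 \<le> \<kappa>\<^sup>2 / 128 * s" using c(3) by (rule scale)
          then have "real s * 1 \<le> real s * (\<kappa>\<^sup>2 / 128 * s)" by (intro mult_left_mono) auto
          also have "\<dots> = (\<kappa> / 8 * s)\<^sup>2 / 2" by (simp add: power2_eq_square)
          finally have "1 + real s \<le> 1 + \<kappa> / 8 * s + (\<kappa> / 8 * s)\<^sup>2 / 2"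
            using mult_nonneg_nonneg[of "\<kappa> / 8" "real s"] \<kappa> by linarith
          also have "\<dots> \<le> exp (\<kappa> / 8 * s)" using \<kappa> by (intro exp_lower_Taylor_quadratic) simp
          finally show "real g + 1 \<le> exp (\<kappa> / 8 * s)" using gs by simp
        qed
        finally show "(\<Sum>y\<le>g. 2 ^ y * (real ((2 * m) choose y) * real (b choose (s - y)))) \<le> exp (\<kappa> / 8 * s) * W" .
      qed (auto intro: sum_nonneg)
      also have "\<dots> = exp (- (\<kappa> / 2 * s)) * (k choose s)"
        by (simp add: W_def mult.assoc[symmetric] flip: exp_add)
      also have "\<dots> \<le> \<eta> * card (small_doubling n s m)"
      proof (intro mult_mono)
        have "1 \<le> \<kappa> * \<eta> / 2 * s" using c(4) by (rule scale)
        then have "1 / \<eta> \<le> \<kappa> / 2 * s" using \<eta> by (simp add: field_simps)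
        also have "\<dots> \<le> exp (\<kappa> / 2 * s)" using exp_ge_add_one_self[of "\<kappa> / 2 * s"] by linarith
        finally show "exp (- (\<kappa> / 2 * s)) \<le> \<eta>" using \<eta> by (simp add: exp_minus field_simps)
        show "real (k choose s) \<le> real (card (small_doubling n s m))"
          using card_small_doubling_ge[OF True k(2)] by simp
      qed (use \<eta> in auto)
      finally show ?thesis .
    qed
  qed
  show thesis by (rule that[OF c_pos main])
qed

text \<open>A diagonal argument: for each fixed \<open>j\<close>, the error 1 / (j + 1) is
  admissible from some \<open>n\<close> on, and \<open>\<eta> n\<close> takes the largest
  \<open>j \<le> n\<close> admissible at \<open>n\<close>. Every \<open>j\<close> eventually belongs
  to \<open>J n\<close>, so the errors tend to 0.\<close>

theorem theorem1p3:
  fixes m s :: "nat \<Rightarrow> nat"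
  assumes "\<And>n. 1 \<le> n \<Longrightarrow> 0 < m n"
    and "\<And>n. 1 \<le> n \<Longrightarrow> 0 < s n"
    and "(\<lambda>n. real (m n)) \<in> o(\<lambda>n. (real (s n))\<^sup>2 / (log 2 (real n))\<^sup>2)"
  shows "\<exists>\<eta> :: nat \<Rightarrow> real. \<eta> \<longlonglongrightarrow> 0 \<and>
    ((\<lambda>n. measure_pmf.prob (pmf_of_set (small_doubling n (s n) (m n)))
            {A. \<exists>P. arith_prog P \<and>
                    real (card P) \<le> real (m n) / 2 + \<eta> n * real (m n) \<and>
                    real (card (A - P)) \<le> \<eta> n * real (s n)})
      \<longlongrightarrow> 1) (inf sequentially (principal {n. small_doubling n (s n) (m n) \<noteq> {}}))"
proof -
  let ?\<A> = "\<lambda>n. small_doubling n (s n) (m n)"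
  define p where "p \<eta> n = measure_pmf.prob (pmf_of_set (?\<A> n)) (near_progression \<eta> (s n) (m n))" for \<eta> n
  \<comment> \<open>Vacuous for an empty family, in accordance with the filter in the
    conclusion.\<close>
  define Q where "Q j n \<longleftrightarrow> (?\<A> n \<noteq> {} \<longrightarrow> 1 - 1 / real (Suc j) \<le> p (1 / real (Suc j)) n)" for j n
  have Q: "\<forall>\<^sub>F n in sequentially. Q j n" for j
  proof -
    let ?\<eta> = "1 / real (Suc j)"
    have "0 < ?\<eta>" by simp
    then obtain c where c: "0 < c"
      "\<And>n s m. \<lbrakk>2 \<le> n; 0 < s; small_doubling n s m \<noteq> {}; real m * (log 2 (real n))\<^sup>2 \<le> c * (real s)\<^sup>2\<rbrakk>
        \<Longrightarrow> real (card (small_doubling n s m - near_progression ?\<eta> s m)) \<le> ?\<eta> * real (card (small_doubling n s m))"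
      by (rule few_far_from_progression) (rule that; blast)
    have "\<forall>\<^sub>F n in sequentially. norm (real (m n)) \<le> c * norm ((real (s n))\<^sup>2 / (log 2 (real n))\<^sup>2)"
      using landau_o.smallD[OF assms(3) c(1)] .
    moreover have "\<forall>\<^sub>F n in sequentially. 2 \<le> n" by (rule eventually_ge_at_top)
    ultimately show ?thesis
    proof eventually_elim
      case (elim n)
      show ?case unfolding Q_def
      proof
        assume ne: "?\<A> n \<noteq> {}"
        have "0 < log 2 (real n)" using elim(2) by simp
        then have "0 < (log 2 (real n))\<^sup>2" by simp
        then have "real (m n) * (log 2 (real n))\<^sup>2 \<le> c * (real (s n))\<^sup>2"
          using elim(1) by (simp add: field_simps)
        then have bad: "real (card (?\<A> n - near_progression ?\<eta> (s n) (m n))) \<le> ?\<eta> * real (card (?\<A> n))"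
          using elim(2) assms(2)[of n] ne by (intro c(2)) auto
        have fin: "finite (?\<A> n)" by (rule finite_small_doubling)
        have pos: "0 < card (?\<A> n)" using fin ne by (simp add: card_gt_0_iff)
        have "card (?\<A> n) = card (?\<A> n \<inter> near_progression ?\<eta> (s n) (m n))
            + card (?\<A> n - near_progression ?\<eta> (s n) (m n))"
          using fin by (metis Int_Diff_Un Int_Diff_disjoint card_Un_disjoint finite_Diff finite_Int)
        then have "(1 - ?\<eta>) * real (card (?\<A> n)) \<le> real (card (?\<A> n \<inter> near_progression ?\<eta> (s n) (m n)))"
          using bad by (simp add: algebra_simps)
        then show "1 - ?\<eta> \<le> p ?\<eta> n"
          unfolding p_def measure_pmf_of_set[OF ne fin] using pos by (simp add: pos_le_divide_eq)
      qed
    qed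
  qed
  define J where "J n = {j \<in> {..n}. Q j n}" for n
  define \<eta> where "\<eta> n = (if J n = {} then 1 else 1 / real (Suc (Max (J n))))" for n
  have fin_J: "finite (J n)" for n by (simp add: J_def)
  have J: "\<forall>\<^sub>F n in sequentially. j \<in> J n" for j
    using Q[of j] eventually_ge_at_top[of j] by eventually_elim (simp add: J_def)
  have "\<eta> \<longlonglongrightarrow> 0"
  proof (rule LIMSEQ_I)
    fix r :: real assume "0 < r"
    then obtain j where j: "1 / real (Suc j) < r" using nat_approx_posE by blast
    obtain n0 where n0: "\<And>n. n0 \<le> n \<Longrightarrow> j \<in> J n" using J[of j] by (auto simp: eventually_sequentially)
    have "norm (\<eta> n - 0) < r" if "n0 \<le> n" for n
    proof -
      have "j \<le> Max (J n)" using n0[OF that] fin_J by simp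
      then have "1 / real (Suc (Max (J n))) \<le> 1 / real (Suc j)" by (intro divide_left_mono) auto
      moreover have "J n \<noteq> {}" using n0[OF that] by auto
      ultimately show ?thesis using j by (simp add: \<eta>_def)
    qed
    then show "\<exists>no. \<forall>n\<ge>no. norm (\<eta> n - 0) < r" by blast
  qed
  moreover have "((\<lambda>n. p (\<eta> n) n) \<longlongrightarrow> 1) (inf sequentially (principal {n. ?\<A> n \<noteq> {}}))"
  proof (rule tendsto_sandwich)
    show "\<forall>\<^sub>F n in inf sequentially (principal {n. ?\<A> n \<noteq> {}}). 1 - \<eta> n \<le> p (\<eta> n) n"
      unfolding eventually_inf_principal using J[of 0]
    proof eventually_elim
      case (elim n)
      then have "J n \<noteq> {}" by auto
      then have "Max (J n) \<in> J n" using fin_J by (intro Max_in) auto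
      moreover have "Q j n" if "j \<in> J n" for j using that by (simp add: J_def)
      ultimately have "Q (Max (J n)) n" by blast
      moreover have "\<eta> n = 1 / real (Suc (Max (J n)))" using \<open>J n \<noteq> {}\<close> by (simp add: \<eta>_def)
      ultimately show ?case unfolding Q_def by simp
    qed
    show "\<forall>\<^sub>F n in inf sequentially (principal {n. ?\<A> n \<noteq> {}}). p (\<eta> n) n \<le> 1"
      by (simp add: p_def)
    have "(\<lambda>n. 1 - \<eta> n) \<longlonglongrightarrow> 1 - 0" using \<open>\<eta> \<longlonglongrightarrow> 0\<close> by (intro tendsto_diff tendsto_const)
    then have "(\<lambda>n. 1 - \<eta> n) \<longlonglongrightarrow> 1" by simp
    then show "((\<lambda>n. 1 - \<eta> n) \<longlongrightarrow> 1) (inf sequentially (principal {n. ?\<A> n \<noteq> {}}))"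
      by (rule tendsto_mono[OF inf_le1])
  qed (rule tendsto_const)
  ultimately show ?thesis unfolding p_def near_progression_def by blast
qed

end
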